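(* (The Liouville theorem in $p$-parabolic spaces.) Let $1<p<\infty$. Assume that $X$ is a proper connected metric space equipped with a locally doubling measure $\mu$ that supports a local $p$-Poincaré inequality. If $X$ is $p$-parabolic or bounded, then every nonnegative quasisuperharmonic function in $X$ is constant.
   Context: Setting. $X=(X,d,\mu)$ is a metric space with at least two points, equipped with a positive complete Borel measure $\mu$ such that $0<\mu(B)<\infty$ for all balls $B\subset X$. Balls $B(x,r)=\{y:d(x,y)<r\}$ are open and come with a predetermined centre and radius; $\lambda B(x,r)=B(x,\lambda r)$. $X$ is proper if all closed bounded sets are compact. Upper gradients. Curves are compact and rectifiable, parameterized by arc length. A property holds for $p$-almost every nonconstant rectifiable curve if there is a nonnegative $\rho\in L^p(X)$ with $\int_\gamma\rho\,ds=\infty$ for every curve $\gamma$ for which the property fails. A measurable $g:X\to[0,\infty]$ is a $p$-weak upper gradient of $f:X\to[-\infty,\infty]$ if $|f(\gamma(0))-f(\gamma(\ell_\gamma))|\le\int_\gamma g\,ds$ for $p$-almost every nonconstant rectifiable curve $\gamma:[0,\ell_\gamma]\to X$ (left-hand side $=\infty$ if at least one of its terms is infinite). If $f$ has a $p$-weak upper gradient in $L^p_{\rm loc}$, then $g_f$ denotes its minimal one: $g_f\le g$ a.e. for every $p$-weak upper gradient $g\in L^p_{\rm loc}$ of $f$. Newtonian spaces. For measurable $f$ (defined everywhere), $\|f\|_{N^{1,p}(X)}^p=\int_X|f|^p\,d\mu+\inf_g\int_X g^p\,d\mu$, infimum over all $p$-weak upper gradients $g$ of $f$; $N^{1,p}(X)=\{f:\|f\|_{N^{1,p}(X)}<\infty\}$.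 For measurable $E\subset X$, $N^{1,p}(E)$ is defined by regarding $(E,d|_E,\mu|_E)$ as a metric space in its own right; for open $\Omega$, $f\in N^{1,p}_{\rm loc}(\Omega)$ if every $x\in\Omega$ has a ball $B_x\ni x$ (in $\Omega$) with $f\in N^{1,p}(B_x)$. $N^{1,p}_0(\Omega)=\{\phi|_\Omega:\phi\in N^{1,p}(X),\ \phi=0\text{ on }X\setminus\Omega\}$. Doubling and Poincaré. $\mu$ is doubling within an open set $U$ if there is $C>0$ with $\mu(2B)\le C\mu(B)$ for all balls $B\subset U$. The $p$-Poincaré inequality holds within $U$ if there are $C>0$ and $\lambda\ge1$ such that for all balls $B\subset U$ (of radius $r_B$), all integrable $u$ in $\lambda B$ and all $p$-weak upper gradients $g$ of $u$ in $\lambda B$, $\frac1{\mu(B)}\int_B|u-u_B|\,d\mu\le Cr_B\bigl(\frac1{\mu(\lambda B)}\int_{\lambda B}g^p\,d\mu\bigr)^{1/p}$, where $u_B=\frac1{\mu(B)}\int_Bu\,d\mu$. Each property is local if every $x\in X$ has some $r>0$ such that it holds within $B(x,r)$. Quasisuperharmonic functions. Let $\Omega\subset X$ be open and $Q\ge1$. $u\in N^{1,p}_{\rm loc}(\Omega)$ is a $Q$-quasisuperminimizer in $\Omega$ if $\int_{\phi\ne0}g_u^p\,d\mu\le Q\int_{\phi\ne0}g_{u+\phi}^p\,d\mu$ for all $0\le\phi\in N^{1,p}_0(\Omega)$. A function $u:\Omega\to(-\infty,\infty]$ is $Q$-quasisuperharmonic in $\Omega$ if (a) $u(x)=\operatorname{ess\,lim\,inf}_{y\to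 x}u(y)$ for all $x\in\Omega$; (b) $u$ is not identically $\infty$ in any component of $\Omega$; and (c) $\min\{u,k\}$ is a $Q$-quasisuperminimizer in $\Omega$ for every $k\in\mathbb R$. Quasisuperharmonic means $Q$-quasisuperharmonic for some $Q\ge1$. Parabolicity. For compact $K\subset X$, $\operatorname{cap}_p(K,X)=\inf\int_Xg_u^p\,d\mu$, infimum over compactly supported Lipschitz functions $u$ on $X$ with $u\ge1$ on $K$. An unbounded $X$ is $p$-hyperbolic if $\operatorname{cap}_p(K,X)>0$ for some compact $K\subset X$, and $p$-parabolic otherwise. *)

theory Defs
  imports "HOL-Analysis.Analysis"
begin

text \<open>
  A metric measure space is given by a measure \<open>M\<close> on a type of class \<open>metric_space\<close>;
  the underlying set is \<open>space M\<close> and the metric is \<open>dist\<close>. A measurable subset \<open>E\<close>, regarded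
  as a metric measure space in its own right, is then \<open>restrict_space M E\<close>.
\<close>

definition complete_borel_measure :: "'a::metric_space measure \<Rightarrow> bool" where
  "complete_borel_measure M \<longleftrightarrow> (\<exists>N. sets N = sets borel \<and> M = completion N)"

definition proper_metric :: "'a::metric_space itself \<Rightarrow> bool" where
  "proper_metric _ \<longleftrightarrow> (\<forall>S::'a set. closed S \<and> bounded S \<longrightarrow> compact S)"

definition epowr :: "ennreal \<Rightarrow> real \<Rightarrow> ennreal" where
  "epowr x a = (if x = \<infinity> then \<infinity> else ennreal (enn2real x powr a))"


subsection \<open>Curves and weak upper gradients\<close>

definition curve_length :: "(real \<Rightarrow> 'a::metric_space) \<Rightarrow> real \<Rightarrow> real \<Rightarrow> ennreal" where
  "curve_length \<gamma> a b =
     (SUP (n, t) \<in> {(n, t). mono t \<and> t (0::nat) = a \<and> t n = b}.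
        ennreal (\<Sum>i<n. dist (\<gamma> (t i)) (\<gamma> (t (Suc i)))))"

text \<open>Nonconstant (\<open>0 < l\<close>) compact rectifiable curves \<open>[0, l] \<rightarrow> E\<close>, parametrized by arc length.\<close>
definition arclength_curve :: "'a::metric_space set \<Rightarrow> (real \<Rightarrow> 'a) \<Rightarrow> real \<Rightarrow> bool" where
  "arclength_curve E \<gamma> l \<longleftrightarrow>
     0 < l \<and> continuous_on {0..l} \<gamma> \<and> \<gamma> ` {0..l} \<subseteq> E \<and>
     (\<forall>t\<in>{0..l}. curve_length \<gamma> 0 t = ennreal t)"

text \<open>
  The integrand need not be measurable along \<open>\<gamma>\<close>; the nonnegative integral is then the lower
  integral. This is harmless: a function measurable for a completed Borel measure lies below a
  Borel function that is equal to it almost everywhere, and the two agree a.e. along almost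
  every curve.
\<close>
definition curve_integral :: "(real \<Rightarrow> 'a::metric_space) \<Rightarrow> real \<Rightarrow> ('a \<Rightarrow> ennreal) \<Rightarrow> ennreal" where
  "curve_integral \<gamma> l g = (\<integral>\<^sup>+ t\<in>{0..l}. g (\<gamma> t) \<partial>lborel)"

definition almost_every_curve ::
    "'a::metric_space measure \<Rightarrow> real \<Rightarrow> ((real \<Rightarrow> 'a) \<Rightarrow> real \<Rightarrow> bool) \<Rightarrow> bool" where
  "almost_every_curve M p P \<longleftrightarrow>
     (\<exists>\<rho>\<in>borel_measurable M. (\<integral>\<^sup>+ x. epowr (\<rho> x) p \<partial>M) < \<infinity> \<and>
        (\<forall>\<gamma> l. arclength_curve (space M) \<gamma> l \<and> \<not> P \<gamma> l \<longrightarrow> curve_integral \<gamma> l \<rho> = \<infinity>))"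

definition oscillation :: "ereal \<Rightarrow> ereal \<Rightarrow> ennreal" where
  "oscillation a b = (if \<bar>a\<bar> = \<infinity> \<or> \<bar>b\<bar> = \<infinity> then \<infinity> else e2ennreal \<bar>a - b\<bar>)"

definition weak_upper_gradient ::
    "'a::metric_space measure \<Rightarrow> real \<Rightarrow> ('a \<Rightarrow> ereal) \<Rightarrow> ('a \<Rightarrow> ennreal) \<Rightarrow> bool" where
  "weak_upper_gradient M p f g \<longleftrightarrow>
     g \<in> borel_measurable M \<and>
     almost_every_curve M p (\<lambda>\<gamma> l. oscillation (f (\<gamma> 0)) (f (\<gamma> l)) \<le> curve_integral \<gamma> l g)"

definition Lp_loc :: "'a::metric_space measure \<Rightarrow> real \<Rightarrow> ('a \<Rightarrow> ennreal) \<Rightarrow> bool" where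
  "Lp_loc M p g \<longleftrightarrow> g \<in> borel_measurable M \<and>
     (\<forall>x\<in>space M. \<exists>r>0. (\<integral>\<^sup>+ y\<in>ball x r. epowr (g y) p \<partial>M) < \<infinity>)"

definition is_minimal_weak_upper_gradient ::
    "'a::metric_space measure \<Rightarrow> real \<Rightarrow> ('a \<Rightarrow> ereal) \<Rightarrow> ('a \<Rightarrow> ennreal) \<Rightarrow> bool" where
  "is_minimal_weak_upper_gradient M p f g \<longleftrightarrow>
     weak_upper_gradient M p f g \<and> Lp_loc M p g \<and>
     (\<forall>h. weak_upper_gradient M p f h \<and> Lp_loc M p h \<longrightarrow> (AE x in M. g x \<le> h x))"

text \<open>Meaningful only if \<open>f\<close> has a weak upper gradient in \<open>L\<^sup>p\<^sub>l\<^sub>o\<^sub>c\<close>; unique up to null sets.\<close>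
definition minimal_weak_upper_gradient ::
    "'a::metric_space measure \<Rightarrow> real \<Rightarrow> ('a \<Rightarrow> ereal) \<Rightarrow> 'a \<Rightarrow> ennreal" where
  "minimal_weak_upper_gradient M p f = (SOME g. is_minimal_weak_upper_gradient M p f g)"


subsection \<open>Newtonian spaces\<close>

text \<open>The \<open>p\<close>-th power of the Newtonian norm.\<close>
definition newtonian_norm_pow :: "'a::metric_space measure \<Rightarrow> real \<Rightarrow> ('a \<Rightarrow> ereal) \<Rightarrow> ennreal" where
  "newtonian_norm_pow M p f =
     (\<integral>\<^sup>+ x. epowr (e2ennreal \<bar>f x\<bar>) p \<partial>M) +
     (INF g\<in>{g. weak_upper_gradient M p f g}. \<integral>\<^sup>+ x. epowr (g x) p \<partial>M)"

definition newtonian :: "'a::metric_space measure \<Rightarrow> real \<Rightarrow> ('a \<Rightarrow> ereal) set" where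
  "newtonian M p = {f \<in> borel_measurable M. newtonian_norm_pow M p f < \<infinity>}"

text \<open>
  In the following two definitions a function on \<open>\<Omega>\<close> is a function on the whole type whose
  values outside \<open>\<Omega>\<close> are irrelevant.
\<close>
definition newtonian_loc ::
    "'a::metric_space measure \<Rightarrow> real \<Rightarrow> 'a set \<Rightarrow> ('a \<Rightarrow> ereal) set" where
  "newtonian_loc M p \<Omega> =
     {f. \<forall>x\<in>\<Omega>. \<exists>z r. x \<in> ball z r \<and> ball z r \<subseteq> \<Omega> \<and> f \<in> newtonian (restrict_space M (ball z r)) p}"

definition newtonian_zero ::
    "'a::metric_space measure \<Rightarrow> real \<Rightarrow> 'a set \<Rightarrow> ('a \<Rightarrow> ereal) set" where
  "newtonian_zero M p \<Omega> =
     {\<phi>. \<exists>\<psi>\<in>newtonian M p. (\<forall>x\<in>space M - \<Omega>. \<psi> x = 0) \<and> (\<forall>x\<in>\<Omega>. \<phi> x = \<psi> x)}"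


subsection \<open>Local doubling and local Poincare inequality\<close>

definition doubling_within :: "'a::metric_space measure \<Rightarrow> 'a set \<Rightarrow> bool" where
  "doubling_within M U \<longleftrightarrow>
     (\<exists>C>0. \<forall>z r. 0 < r \<and> ball z r \<subseteq> U \<longrightarrow>
        emeasure M (ball z (2 * r)) \<le> ennreal C * emeasure M (ball z r))"

definition locally_doubling :: "'a::metric_space measure \<Rightarrow> bool" where
  "locally_doubling M \<longleftrightarrow> (\<forall>x. \<exists>r>0. doubling_within M (ball x r))"

text \<open>For \<open>u\<close> integrable, hence a.e. finite, \<open>real_of_ereal\<close> only changes \<open>u\<close> on a null set.\<close>
definition ball_mean :: "'a::metric_space measure \<Rightarrow> 'a set \<Rightarrow> ('a \<Rightarrow> ereal) \<Rightarrow> real" where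
  "ball_mean M B u = (LINT x:B|M. real_of_ereal (u x)) / measure M B"

definition poincare_within :: "'a::metric_space measure \<Rightarrow> real \<Rightarrow> 'a set \<Rightarrow> bool" where
  "poincare_within M p U \<longleftrightarrow>
     (\<exists>C>0. \<exists>\<Lambda>\<ge>1. \<forall>z r u g.
        0 < r \<and> ball z r \<subseteq> U \<and>
        u \<in> borel_measurable (restrict_space M (ball z (\<Lambda> * r))) \<and>
        (\<integral>\<^sup>+ x\<in>ball z (\<Lambda> * r). e2ennreal \<bar>u x\<bar> \<partial>M) < \<infinity> \<and>
        weak_upper_gradient (restrict_space M (ball z (\<Lambda> * r))) p u g \<longrightarrow>
        (\<integral>\<^sup>+ x\<in>ball z r. e2ennreal \<bar>u x - ereal (ball_mean M (ball z r) u)\<bar> \<partial>M)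
            / emeasure M (ball z r)
          \<le> ennreal (C * r) *
            epowr ((\<integral>\<^sup>+ x\<in>ball z (\<Lambda> * r). epowr (g x) p \<partial>M) / emeasure M (ball z (\<Lambda> * r))) (1 / p))"

definition local_poincare :: "'a::metric_space measure \<Rightarrow> real \<Rightarrow> bool" where
  "local_poincare M p \<longleftrightarrow> (\<forall>x. \<exists>r>0. poincare_within M p (ball x r))"


subsection \<open>Quasisuperharmonic functions\<close>

definition quasisuperminimizer ::
    "'a::metric_space measure \<Rightarrow> real \<Rightarrow> real \<Rightarrow> 'a set \<Rightarrow> ('a \<Rightarrow> ereal) \<Rightarrow> bool" where
  "quasisuperminimizer M p Q \<Omega> u \<longleftrightarrow>
     u \<in> newtonian_loc M p \<Omega> \<and>
     (\<forall>\<phi>\<in>newtonian_zero M p \<Omega>. (\<forall>x\<in>\<Omega>. 0 \<le> \<phi> x) \<longrightarrow>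
        (\<integral>\<^sup>+ x\<in>{x\<in>\<Omega>. \<phi> x \<noteq> 0}.
            epowr (minimal_weak_upper_gradient (restrict_space M \<Omega>) p u x) p \<partial>M)
        \<le> ennreal Q *
          (\<integral>\<^sup>+ x\<in>{x\<in>\<Omega>. \<phi> x \<noteq> 0}.
            epowr (minimal_weak_upper_gradient (restrict_space M \<Omega>) p (\<lambda>y. u y + \<phi> y) x) p \<partial>M))"

definition ess_inf_on :: "'a measure \<Rightarrow> 'a set \<Rightarrow> ('a \<Rightarrow> ereal) \<Rightarrow> ereal" where
  "ess_inf_on M A u = Sup {c. AE y in M. y \<in> A \<longrightarrow> c \<le> u y}"

text \<open>The limit of the essential infima over \<open>ball x r\<close> as \<open>r\<close> decreases to \<open>0\<close>.\<close>
definition ess_liminf ::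
    "'a::metric_space measure \<Rightarrow> 'a set \<Rightarrow> ('a \<Rightarrow> ereal) \<Rightarrow> 'a \<Rightarrow> ereal" where
  "ess_liminf M \<Omega> u x = (SUP r\<in>{0<..}. ess_inf_on M (\<Omega> \<inter> ball x r) u)"

definition Q_quasisuperharmonic ::
    "'a::metric_space measure \<Rightarrow> real \<Rightarrow> real \<Rightarrow> 'a set \<Rightarrow> ('a \<Rightarrow> ereal) \<Rightarrow> bool" where
  "Q_quasisuperharmonic M p Q \<Omega> u \<longleftrightarrow>
     (\<forall>x\<in>\<Omega>. u x \<noteq> -\<infinity>) \<and>
     (\<forall>x\<in>\<Omega>. u x = ess_liminf M \<Omega> u x) \<and>
     (\<forall>C\<in>components \<Omega>. \<exists>x\<in>C. u x \<noteq> \<infinity>) \<and>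
     (\<forall>k::real. quasisuperminimizer M p Q \<Omega> (\<lambda>x. min (u x) (ereal k)))"

definition quasisuperharmonic ::
    "'a::metric_space measure \<Rightarrow> real \<Rightarrow> 'a set \<Rightarrow> ('a \<Rightarrow> ereal) \<Rightarrow> bool" where
  "quasisuperharmonic M p \<Omega> u \<longleftrightarrow> (\<exists>Q\<ge>1. Q_quasisuperharmonic M p Q \<Omega> u)"


subsection \<open>Parabolicity\<close>

definition p_capacity :: "'a::metric_space measure \<Rightarrow> real \<Rightarrow> 'a set \<Rightarrow> ennreal" where
  "p_capacity M p K =
     (INF u\<in>{u :: 'a \<Rightarrow> real. (\<exists>L. L-lipschitz_on UNIV u) \<and>
                compact (closure {x. u x \<noteq> 0}) \<and> (\<forall>x\<in>K. 1 \<le> u x)}.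
        \<integral>\<^sup>+ x. epowr (minimal_weak_upper_gradient M p (\<lambda>y. ereal (u y)) x) p \<partial>M)"

definition p_hyperbolic :: "'a::metric_space measure \<Rightarrow> real \<Rightarrow> bool" where
  "p_hyperbolic M p \<longleftrightarrow>
     \<not> bounded (UNIV :: 'a set) \<and> (\<exists>K. compact K \<and> 0 < p_capacity M p K)"

definition p_parabolic :: "'a::metric_space measure \<Rightarrow> real \<Rightarrow> bool" where
  "p_parabolic M p \<longleftrightarrow> \<not> bounded (UNIV :: 'a set) \<and> \<not> p_hyperbolic M p"

end

theory Submission
  imports Defs
begin

text \<open>
  Let \<open>v = min u k\<close> with a real \<open>k \<ge> 0\<close>. The heart of the proof is one test function. Let \<open>\<eta>\<close> be Lipschitz
  with compact support and \<open>\<eta> \<ge> 1\<close> on a compact set \<open>K\<close>, and put \<open>w = (k + 1) \<eta>\<close> and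
  \<open>\<phi> = max (w - v) 0\<close>. Since \<open>v \<ge> 0\<close>, the function \<open>\<phi>\<close> vanishes outside the support of \<open>\<eta>\<close>, so
  it is admissible, and \<open>v + \<phi> = max v w\<close> coincides with \<open>w\<close> on \<open>{\<phi> \<noteq> 0} = {v < w}\<close>, a set which
  contains \<open>K\<close> because \<open>v < k + 1\<close>. Hence the quasiminimizing property gives
  \<open>\<integral>\<^bsub>K\<^esub> g\<^bsub>v\<^esub>\<^sup>p \<le> Q (k + 1)\<^sup>p \<integral> g\<^bsub>\<eta>\<^esub>\<^sup>p\<close> at once (lemma \<open>energy_estimate\<close>). The
  infimum over \<open>\<eta>\<close> on the right-hand side is the capacity of \<open>K\<close>, which is zero both in the
  parabolic and in the bounded case. So \<open>g\<^bsub>v\<^esub> = 0\<close> almost everywhere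
  (\<open>minimal_weak_upper_gradient_eq_0\<close>), the local Poincare inequality makes \<open>v\<close> almost everywhere
  constant on small balls (\<open>AE_eq_const_on_ball\<close>), and the regularity of \<open>u\<close> expressed by the
  essential lower limit turns this into equality everywhere (\<open>ess_liminf_eq_AE_const\<close>). As the
  space is connected, all truncations of \<open>u\<close>, and therefore \<open>u\<close> itself, are constant.

  The estimate is only meaningful if minimal weak upper gradients exist, and it needs their locality
  on \<open>{v < w}\<close>. Both are reduced to functions on an interval: a weak upper gradient of \<open>f\<close>
  controls \<open>f\<close> on all subcurves of almost every curve, so upper gradients can be modified on
  subintervals, hence on open sets, and, by approximation from outside, on Borel sets. This yields
  stability of upper gradients under minima and countable infima (\<open>interval_upper_gradient_INF\<close>),
  which gives the existence of a minimal one (\<open>minimal_weak_upper_gradient\<close>), and locality on open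
  sets (\<open>interval_upper_gradient_replace_open\<close>, \<open>upper_gradient_max_along\<close>).

  A locally Newtonian function comes with upper gradients on small balls only. A locally finite
  supremum glues them to an upper gradient on the whole space, since compact curves split
  into finitely many pieces each of which lies in one ball (\<open>locally_newtonian_upper_gradient\<close>).
\<close>

section \<open>Powers of extended nonnegative numbers\<close>

text \<open>
  Thus \<open>g \<mapsto> inverse (1 + g)\<close> is a bounded strictly decreasing transform, finite also where \<open>g\<close> is
  infinite: maximizing its integral selects a smallest \<open>g\<close>.
\<close>
lemma ennreal_inverse_one_plus_le_iff:
  "inverse (1 + a) \<le> inverse (1 + b :: ennreal) \<longleftrightarrow> b \<le> a"
proof (cases a; cases b)
  fix x y :: real assume *: "a = ennreal x" "0 \<le> x" "b = ennreal y" "0 \<le> y"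
  have "1 + a = ennreal (1 + x)" "1 + b = ennreal (1 + y)"
    using * by simp_all
  moreover have "0 < 1 + x" "0 < 1 + y" using * by auto
  ultimately show ?thesis using *
    by (simp add: inverse_ennreal ennreal_le_iff inverse_le_iff_le del: ennreal_plus)
qed (auto simp: top_unique)

lemma epowr_0 [simp]: "epowr 0 a = 0" by (simp add: epowr_def)

lemma epowr_top [simp]: "epowr top a = top" by (simp add: epowr_def)

lemma epowr_mono: "0 \<le> a \<Longrightarrow> x \<le> y \<Longrightarrow> epowr x a \<le> epowr y a"
  by (auto simp: epowr_def enn2real_mono less_top top_unique intro!: ennreal_leI powr_mono2)

lemma epowr_ennreal: "0 \<le> x \<Longrightarrow> epowr (ennreal x) a = ennreal (x powr a)"
  by (simp add: epowr_def)

lemma epowr_eq_0_iff [simp]: "epowr x a = 0 \<longleftrightarrow> x = 0"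
  by (cases x) (auto simp: epowr_def)

lemma epowr_epowr: "epowr (epowr x a) b = epowr x (a * b)"
  by (cases x) (auto simp: epowr_ennreal powr_powr)

lemma epowr_1 [simp]: "epowr x 1 = x"
  by (cases x) (auto simp: epowr_ennreal)

text \<open>
  In this form the power of a supremum can be estimated term by term.
\<close>
lemma epowr_le_iff:
  assumes "0 < a" shows "epowr x a \<le> y \<longleftrightarrow> x \<le> epowr y (1 / a)"
proof
  assume "epowr x a \<le> y"
  from epowr_mono[OF _ this, of "1 / a"] assms show "x \<le> epowr y (1 / a)" by (simp add: epowr_epowr)
next
  assume "x \<le> epowr y (1 / a)"
  from epowr_mono[OF _ this, of a] assms show "epowr x a \<le> y" by (simp add: epowr_epowr)
qed

lemma epowr_mult: "0 \<le> c \<Longrightarrow> epowr (ennreal c * x) a = ennreal (c powr a) * epowr x a"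
proof (cases x)
  case (real r)
  assume "0 \<le> c"
  with real show ?thesis by (simp add: epowr_ennreal powr_mult flip: ennreal_mult)
next
  case top
  assume "0 \<le> c"
  then show ?thesis using top by (cases "c = 0") (auto simp: ennreal_mult_top)
qed

lemma epowr_max: "0 \<le> a \<Longrightarrow> epowr (max x y) a = max (epowr x a) (epowr y a)"
  using epowr_mono[of a x y] epowr_mono[of a y x] by (auto simp: max_def)

lemma epowr_add_le:
  assumes "0 \<le> a" shows "epowr (x + y) a \<le> ennreal (2 powr a) * (epowr x a + epowr y a)"
proof -
  have "x + y \<le> ennreal 2 * max x y" by (auto simp: max_def mult_2 intro: add_mono)
  from epowr_mono[OF assms this]
  have "epowr (x + y) a \<le> ennreal (2 powr a) * max (epowr x a) (epowr y a)"
    using assms by (simp add: epowr_mult epowr_max del: ennreal_numeral)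
  also have "\<dots> \<le> ennreal (2 powr a) * (epowr x a + epowr y a)"
    by (intro mult_left_mono) (auto simp: add_increasing add_increasing2)
  finally show ?thesis .
qed

lemma epowr_SUP_le:
  fixes f :: "'i \<Rightarrow> ennreal"
  assumes "0 < a" "\<And>i. i \<in> I \<Longrightarrow> epowr (f i) a \<le> S" shows "epowr (SUP i\<in>I. f i) a \<le> S"
  using assms by (simp add: epowr_le_iff SUP_le_iff)

lemma borel_measurable_epowr [measurable]:
  assumes [measurable]: "g \<in> borel_measurable N"
  shows "(\<lambda>x. epowr (g x) a) \<in> borel_measurable N"
proof -
  have [measurable]: "Measurable.pred N (\<lambda>x. g x = \<infinity>)"
    using measurable_sets[OF assms, of "{\<infinity>}"]
    by (simp add: pred_def vimage_def Int_def conj_commute)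
  have [measurable]: "(\<lambda>_. a) \<in> borel_measurable N" by (rule borel_measurable_const)
  show ?thesis unfolding epowr_def by measurable
qed

section \<open>Upper gradients on an interval\<close>

text \<open>
  The upper gradient inequality for one subinterval; \<open>a\<close> plays the role of \<open>g \<circ> \<gamma>\<close>.
\<close>
definition increment_le :: "(real \<Rightarrow> real) \<Rightarrow> (real \<Rightarrow> ennreal) \<Rightarrow> real \<Rightarrow> real \<Rightarrow> bool" where
  "increment_le F a s t \<longleftrightarrow> ennreal \<bar>F t - F s\<bar> \<le> (\<integral>\<^sup>+x\<in>{s..t}. a x \<partial>lborel)"

definition interval_upper_gradient :: "real \<Rightarrow> (real \<Rightarrow> real) \<Rightarrow> (real \<Rightarrow> ennreal) \<Rightarrow> bool" where
  "interval_upper_gradient l F a \<longleftrightarrow> (\<forall>s t. 0 \<le> s \<longrightarrow> s \<le> t \<longrightarrow> t \<le> l \<longrightarrow> increment_le F a s t)"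

lemma interval_upper_gradientD:
  "interval_upper_gradient l F a \<Longrightarrow> 0 \<le> s \<Longrightarrow> s \<le> t \<Longrightarrow> t \<le> l \<Longrightarrow> increment_le F a s t"
  by (auto simp: interval_upper_gradient_def)

lemma increment_le_mono:
  assumes "increment_le F a s t" "\<And>x. s \<le> x \<Longrightarrow> x \<le> t \<Longrightarrow> a x \<le> b x"
  shows "increment_le F b s t"
proof -
  have "(\<integral>\<^sup>+x\<in>{s..t}. a x \<partial>lborel) \<le> (\<integral>\<^sup>+x\<in>{s..t}. b x \<partial>lborel)"
    using assms(2) by (intro nn_integral_mono) (auto split: split_indicator)
  with assms(1) show ?thesis unfolding increment_le_def by order
qed

lemma increment_le_cong_AE:
  assumes "AE x in lborel. x \<in> {s..t} \<longrightarrow> a x = b x"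
  shows "increment_le F a s t \<longleftrightarrow> increment_le F b s t"
proof -
  have "(\<integral>\<^sup>+x\<in>{s..t}. a x \<partial>lborel) = (\<integral>\<^sup>+x\<in>{s..t}. b x \<partial>lborel)"
  proof (rule nn_integral_cong_AE)
    show "AE x in lborel. a x * indicator {s..t} x = b x * indicator {s..t} x"
      using assms by eventually_elim (simp split: split_indicator)
  qed
  then show ?thesis unfolding increment_le_def by simp
qed

lemma nn_integral_Icc_combine:
  assumes [measurable]: "a \<in> borel_measurable borel" and "r \<le> s" "s \<le> (t::real)"
  shows "(\<integral>\<^sup>+x\<in>{r..t}. a x \<partial>lborel) = (\<integral>\<^sup>+x\<in>{r..s}. a x \<partial>lborel) + (\<integral>\<^sup>+x\<in>{s..t}. a x \<partial>lborel)"
proof -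
  have "(\<integral>\<^sup>+x\<in>{r..t}. a x \<partial>lborel)
      = (\<integral>\<^sup>+x. a x * indicator {r..s} x + a x * indicator {s..t} x \<partial>lborel)"
    by (rule nn_integral_cong_AE, rule AE_mp[OF AE_lborel_singleton[of s]])
      (use assms(2,3) in \<open>auto split: split_indicator\<close>)
  then show ?thesis by (simp add: nn_integral_add)
qed

lemma increment_le_trans:
  assumes "a \<in> borel_measurable borel" "r \<le> s" "s \<le> t"
    and "increment_le F a r s" "increment_le F a s t"
  shows "increment_le F a r t"
proof -
  have "ennreal \<bar>F t - F r\<bar> \<le> ennreal (\<bar>F s - F r\<bar> + \<bar>F t - F s\<bar>)"
    by (intro ennreal_leI) linarith
  also have "\<dots> = ennreal \<bar>F s - F r\<bar> + ennreal \<bar>F t - F s\<bar>" by simp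
  also have "\<dots> \<le> (\<integral>\<^sup>+x\<in>{r..s}. a x \<partial>lborel) + (\<integral>\<^sup>+x\<in>{s..t}. a x \<partial>lborel)"
    using assms(4,5) unfolding increment_le_def by (rule add_mono)
  also have "\<dots> = (\<integral>\<^sup>+x\<in>{r..t}. a x \<partial>lborel)"
    using nn_integral_Icc_combine[OF assms(1-3)] by simp
  finally show ?thesis unfolding increment_le_def .
qed

text \<open>
  The triangle inequality splits any \<open>[s, t]\<close> at the end points of \<open>[c, d]\<close>; the finitely many end
  points are null for Lebesgue measure.
\<close>
lemma interval_upper_gradient_replace_interval:
  assumes a [measurable]: "a \<in> borel_measurable borel" and b [measurable]: "b \<in> borel_measurable borel"
    and A: "interval_upper_gradient l F a"
    and B: "\<And>s t. 0 \<le> s \<Longrightarrow> s \<le> t \<Longrightarrow> t \<le> l \<Longrightarrow> c \<le> s \<Longrightarrow> t \<le> d \<Longrightarrow> increment_le F b s t"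
  shows "interval_upper_gradient l F (\<lambda>x. if x \<in> {c..d} then b x else a x)" (is "interval_upper_gradient l F ?h")
  unfolding interval_upper_gradient_def
proof (intro allI impI)
  fix s t :: real assume st: "0 \<le> s" "s \<le> t" "t \<le> l"
  have h [measurable]: "?h \<in> borel_measurable borel" by measurable
  show "increment_le F ?h s t"
  proof (cases "c \<le> d \<and> c \<le> t \<and> s \<le> d")
    case False
    then have "increment_le F ?h s t \<longleftrightarrow> increment_le F a s t"
      by (intro increment_le_cong_AE) auto
    then show ?thesis using interval_upper_gradientD[OF A] st by simp
  next
    case True
    define s' t' where "s' = max c s" and "t' = min d t"
    have o: "s \<le> s'" "s' \<le> t'" "t' \<le> t" using True st by (auto simp: s'_def t'_def)
    have 1: "increment_le F ?h s s' \<longleftrightarrow> increment_le F a s s'"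
      by (rule increment_le_cong_AE, rule AE_mp[OF AE_lborel_singleton[of s']]) (auto simp: s'_def)
    have 2: "increment_le F ?h s' t' \<longleftrightarrow> increment_le F b s' t'"
      by (intro increment_le_cong_AE) (auto simp: s'_def t'_def)
    have 3: "increment_le F ?h t' t \<longleftrightarrow> increment_le F a t' t"
      by (rule increment_le_cong_AE, rule AE_mp[OF AE_lborel_singleton[of t']]) (auto simp: t'_def)
    have "increment_le F ?h s s'" "increment_le F ?h t' t"
      unfolding 1 3 using o st by (auto intro!: interval_upper_gradientD[OF A])
    moreover have "increment_le F ?h s' t'"
      unfolding 2 using o st by (intro B) (auto simp: s'_def t'_def)
    ultimately show ?thesis
      using increment_le_trans[OF h o(1), of t' F] increment_le_trans[OF h _ o(3), of s F] o by simp
  qed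
qed

lemma interval_upper_gradient_limit:
  fixes a :: "nat \<Rightarrow> real \<Rightarrow> ennreal"
  assumes [measurable]: "\<And>n. a n \<in> borel_measurable borel" "h \<in> borel_measurable borel"
      "w \<in> borel_measurable borel"
    and A: "\<And>n. interval_upper_gradient l F (a n)"
    and lim: "AE x in lborel. x \<in> {0..l} \<longrightarrow> (\<lambda>n. a n x) \<longlonglongrightarrow> h x"
    and bound: "\<And>n x. x \<in> {0..l} \<Longrightarrow> a n x \<le> w x"
    and w: "(\<integral>\<^sup>+x\<in>{0..l}. w x \<partial>lborel) < \<infinity>"
  shows "interval_upper_gradient l F h"
  unfolding interval_upper_gradient_def
proof (intro allI impI)
  fix s t :: real assume st: "0 \<le> s" "s \<le> t" "t \<le> l"
  have "(\<lambda>n. \<integral>\<^sup>+x\<in>{s..t}. a n x \<partial>lborel) \<longlonglongrightarrow> (\<integral>\<^sup>+x\<in>{s..t}. h x \<partial>lborel)"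
  proof (rule nn_integral_dominated_convergence[where w = "\<lambda>x. w x * indicator {0..l} x"])
    show "AE x in lborel. a j x * indicator {s..t} x \<le> w x * indicator {0..l} x" for j
      using bound st by (auto split: split_indicator)
    show "AE x in lborel. (\<lambda>i. a i x * indicator {s..t} x) \<longlonglongrightarrow> h x * indicator {s..t} x"
      using lim by eventually_elim (use st in \<open>auto split: split_indicator\<close>)
  qed (use w in auto)
  moreover have "ennreal \<bar>F t - F s\<bar> \<le> (\<integral>\<^sup>+x\<in>{s..t}. a n x \<partial>lborel)" for n
    using interval_upper_gradientD[OF A st] unfolding increment_le_def .
  ultimately show "increment_le F h s t"
    unfolding increment_le_def by (intro LIMSEQ_le_const) auto
qed

text \<open>
  The rational intervals inside \<open>U\<close> are enumerated. Pairs that span an empty interval are admitted: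
  they keep the set of pairs nonempty, so that it has an enumeration even if \<open>U\<close> is empty.
\<close>
lemma open_eq_Union_rational_Icc:
  fixes U :: "real set"
  assumes "open U"
  obtains c d :: "nat \<Rightarrow> real" where "\<And>n. {c n..d n} \<subseteq> U" "U = (\<Union>n. {c n..d n})"
proof -
  define P where "P = {e :: rat \<times> rat. {real_of_rat (fst e)..real_of_rat (snd e)} \<subseteq> U}"
  have P: "(0, -1) \<in> P" by (auto simp: P_def)
  define e where "e = from_nat_into P"
  have e: "range e = P" unfolding e_def using P by (intro range_from_nat_into) auto
  define c d :: "nat \<Rightarrow> real" where "c n = of_rat (fst (e n))" and "d n = of_rat (snd (e n))" for n
  have sub: "{c n..d n} \<subseteq> U" for n
    using e unfolding c_def d_def P_def by blast
  moreover have "U \<subseteq> (\<Union>n. {c n..d n})"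
  proof
    fix x assume "x \<in> U"
    with assms obtain \<epsilon> where \<epsilon>: "\<epsilon> > 0" "ball x \<epsilon> \<subseteq> U" by (auto simp: open_contains_ball)
    obtain q where q: "x - \<epsilon> < of_rat q" "of_rat q < x" using of_rat_dense[of "x - \<epsilon>" x] \<epsilon> by auto
    obtain r where r: "x < of_rat r" "of_rat r < x + \<epsilon>" using of_rat_dense[of x "x + \<epsilon>"] \<epsilon> by auto
    have "{of_rat q..of_rat r} \<subseteq> ball x \<epsilon>" using q r by (auto simp: dist_real_def)
    then have "(q, r) \<in> P" using \<epsilon> by (auto simp: P_def)
    then obtain n where "e n = (q, r)" using e by (metis imageE)
    then have "x \<in> {c n..d n}" using q r by (auto simp: c_def d_def)
    then show "x \<in> (\<Union>n. {c n..d n})" by blast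
  qed
  ultimately show ?thesis using that by blast
qed

text \<open>
  Locality on open sets: an upper gradient may be replaced on \<open>U\<close> by any \<open>b\<close> that controls \<open>F\<close> on the
  intervals inside \<open>U\<close>. The set \<open>U\<close> is exhausted by finite unions of closed intervals, for which
  replacement is the triangle inequality, and dominated convergence passes to the limit.
\<close>
lemma interval_upper_gradient_replace_open:
  assumes a [measurable]: "a \<in> borel_measurable borel" and b [measurable]: "b \<in> borel_measurable borel"
    and fin: "(\<integral>\<^sup>+x\<in>{0..l}. a x \<partial>lborel) < \<infinity>" "(\<integral>\<^sup>+x\<in>{0..l}. b x \<partial>lborel) < \<infinity>"
    and A: "interval_upper_gradient l F a" and U: "open U"
    and B: "\<And>s t. 0 \<le> s \<Longrightarrow> s \<le> t \<Longrightarrow> t \<le> l \<Longrightarrow> {s..t} \<subseteq> U \<Longrightarrow> increment_le F b s t"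
  shows "interval_upper_gradient l F (\<lambda>x. if x \<in> U then b x else a x)"
proof -
  obtain c d where cd: "\<And>n. {c n..d n} \<subseteq> U" "U = (\<Union>n::nat. {c n..d n})"
    using open_eq_Union_rational_Icc[OF U] by blast
  define I where "I n = (\<Union>i<n. {c i..d i})" for n
  define m where "m n x = (if x \<in> I n then b x else a x)" for n x
  have I [measurable]: "I n \<in> sets borel" for n unfolding I_def by auto
  have m [measurable]: "m n \<in> borel_measurable borel" for n unfolding m_def by measurable
  have [measurable]: "U \<in> sets borel" using U by simp
  have iug: "interval_upper_gradient l F (m n)" for n
  proof (induction n)
    case 0 then show ?case using A by (simp add: m_def I_def)
  next
    case (Suc n)
    have "m (Suc n) = (\<lambda>x. if x \<in> {c n..d n} then b x else m n x)"
      by (auto simp: m_def I_def less_Suc_eq fun_eq_iff)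
    moreover have "interval_upper_gradient l F (\<lambda>x. if x \<in> {c n..d n} then b x else m n x)"
    proof (rule interval_upper_gradient_replace_interval[OF m b Suc B])
      fix s t assume "c n \<le> s" "t \<le> d n" then show "{s..t} \<subseteq> U" using cd(1)[of n] by auto
    qed
    ultimately show ?case by simp
  qed
  show ?thesis
  proof (rule interval_upper_gradient_limit[where a = m and w = "\<lambda>x. a x + b x"])
    show "AE x in lborel. x \<in> {0..l} \<longrightarrow> (\<lambda>n. m n x) \<longlonglongrightarrow> (if x \<in> U then b x else a x)"
    proof (intro AE_I2 impI)
      fix x
      have "\<forall>\<^sub>F n in sequentially. m n x = (if x \<in> U then b x else a x)"
      proof (cases "x \<in> U")
        case True
        then obtain i where i: "x \<in> {c i..d i}" using cd by auto
        show ?thesis using eventually_gt_at_top[of i]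
          by eventually_elim (use i True in \<open>auto simp: m_def I_def\<close>)
      next
        case False
        moreover have "I n \<subseteq> U" for n unfolding I_def by (intro UN_least cd(1))
        ultimately have "x \<notin> I n" for n by auto
        then show ?thesis using False by (simp add: m_def)
      qed
      then show "(\<lambda>n. m n x) \<longlonglongrightarrow> (if x \<in> U then b x else a x)" by (rule tendsto_eventually)
    qed
    show "(\<integral>\<^sup>+x\<in>{0..l}. (a x + b x) \<partial>lborel) < \<infinity>"
      using fin by (simp add: distrib_right nn_integral_add)
  qed (use iug in \<open>auto simp: m_def\<close>)
qed

text \<open>
  The minimum equals \<open>b\<close> on \<open>S = {b < a}\<close> and \<open>a\<close> elsewhere. Outer regularity provides a decreasing
  sequence of open sets \<open>V n \<supseteq> S\<close> whose intersection differs from \<open>S\<close> by a null set; on each \<open>V n\<close>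
  the replacement of \<open>a\<close> by \<open>b\<close> is allowed, and the limit is the minimum almost everywhere.
\<close>
lemma interval_upper_gradient_min:
  assumes a [measurable]: "a \<in> borel_measurable borel" and b [measurable]: "b \<in> borel_measurable borel"
    and fin: "(\<integral>\<^sup>+x\<in>{0..l}. a x \<partial>lborel) < \<infinity>" "(\<integral>\<^sup>+x\<in>{0..l}. b x \<partial>lborel) < \<infinity>"
    and A: "interval_upper_gradient l F a" and B: "interval_upper_gradient l F b"
  shows "interval_upper_gradient l F (\<lambda>x. min (a x) (b x))"
proof -
  define S where "S = {x. b x < a x}"
  have S [measurable]: "S \<in> sets borel" unfolding S_def by measurable
  have "\<exists>U. open U \<and> S \<subseteq> U \<and> emeasure lborel (U - S) < ennreal (inverse (Suc n))" for n :: nat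
    by (rule outer_regular_lborel[OF S, of "inverse (Suc n)"]) auto
  then obtain U where U: "\<And>n. open (U n)" "\<And>n. S \<subseteq> U n"
    "\<And>n::nat. emeasure lborel (U n - S) < ennreal (inverse (Suc n))" by metis
  define V where "V n = (\<Inter>i\<le>n. U i)" for n
  have V: "open (V n)" "S \<subseteq> V n" for n using U by (auto simp: V_def)
  have [measurable]: "V n \<in> sets borel" for n using V by simp
  have null: "emeasure lborel ((\<Inter>n. V n) - S) = 0"
  proof -
    have "emeasure lborel ((\<Inter>n. V n) - S) \<le> ennreal (inverse (Suc n))" for n
    proof -
      have "emeasure lborel ((\<Inter>n. V n) - S) \<le> emeasure lborel (U n - S)"
        using U(1) by (intro emeasure_mono) (auto simp: V_def)
      also have "\<dots> \<le> ennreal (inverse (Suc n))" using U(3)[of n] by simp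
      finally show ?thesis .
    qed
    moreover have "(\<lambda>n. ennreal (inverse (Suc n))) \<longlonglongrightarrow> ennreal 0"
      by (intro tendsto_ennrealI LIMSEQ_inverse_real_of_nat)
    ultimately have "emeasure lborel ((\<Inter>n. V n) - S) \<le> ennreal 0"
      by (intro LIMSEQ_le_const) auto
    then show ?thesis by simp
  qed
  have ae: "AE x in lborel. x \<notin> (\<Inter>n. V n) - S"
    by (intro AE_not_in null_setsI null) auto
  show ?thesis
  proof (rule interval_upper_gradient_limit
      [where a = "\<lambda>n x. if x \<in> V n then b x else a x" and w = "\<lambda>x. a x + b x"])
    show "interval_upper_gradient l F (\<lambda>x. if x \<in> V n then b x else a x)" for n
      using interval_upper_gradient_replace_open[OF a b fin A V(1)] interval_upper_gradientD[OF B]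
      by blast
    show "AE x in lborel. x \<in> {0..l} \<longrightarrow>
        (\<lambda>n. if x \<in> V n then b x else a x) \<longlonglongrightarrow> min (a x) (b x)"
      using ae
    proof eventually_elim
      case (elim x)
      have "\<forall>\<^sub>F n in sequentially. (if x \<in> V n then b x else a x) = min (a x) (b x)"
      proof (cases "x \<in> S")
        case True
        then have "x \<in> V n" for n using V(2) by auto
        then show ?thesis using True by (auto simp: S_def min_def)
      next
        case False
        with elim obtain i where i: "x \<notin> V i" by auto
        have "x \<notin> V n" if "n \<ge> i" for n using i that by (auto simp: V_def)
        then show ?thesis using False
          by (intro eventually_mono[OF eventually_ge_at_top[of i]]) (auto simp: S_def min_def)
      qed
      then show ?case using tendsto_eventually by auto
    qed
    show "(\<integral>\<^sup>+x\<in>{0..l}. (a x + b x) \<partial>lborel) < \<infinity>"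
      using fin by (simp add: distrib_right nn_integral_add)
  qed auto
qed

lemma interval_upper_gradient_INF:
  fixes a :: "nat \<Rightarrow> real \<Rightarrow> ennreal"
  assumes a [measurable]: "\<And>n. a n \<in> borel_measurable borel"
    and fin: "\<And>n. (\<integral>\<^sup>+x\<in>{0..l}. a n x \<partial>lborel) < \<infinity>"
    and A: "\<And>n. interval_upper_gradient l F (a n)"
  shows "interval_upper_gradient l F (\<lambda>x. INF n. a n x)"
proof -
  define m where "m n x = (INF i\<in>{..n}. a i x)" for n x
  have m [measurable]: "m n \<in> borel_measurable borel" for n unfolding m_def by measurable
  have m0: "m n x \<le> a 0 x" for n x unfolding m_def by (intro INF_lower) auto
  have mS: "m (Suc n) = (\<lambda>x. min (m n x) (a (Suc n) x))" for n
    by (auto simp: m_def atMost_Suc inf_min min.commute fun_eq_iff)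
  have finm: "(\<integral>\<^sup>+x\<in>{0..l}. m n x \<partial>lborel) < \<infinity>" for n
    by (rule le_less_trans[OF nn_integral_mono fin[of 0]]) (auto split: split_indicator simp: m0)
  have iug: "interval_upper_gradient l F (m n)" for n
  proof (induction n)
    case 0 then show ?case using A by (simp add: m_def)
  next
    case (Suc n)
    show ?case unfolding mS
      by (rule interval_upper_gradient_min[OF m a finm fin Suc A])
  qed
  show ?thesis
  proof (rule interval_upper_gradient_limit[where a = m and w = "a 0"])
    have "decseq (\<lambda>n. m n x)" for x unfolding m_def decseq_def by (auto intro!: INF_superset_mono)
    moreover have "(INF n. m n x) = (INF n. a n x)" for x
      unfolding m_def by (intro antisym INF_greatest) (auto intro: INF_lower INF_lower2)
    ultimately have "(\<lambda>n. m n x) \<longlonglongrightarrow> (INF n. a n x)" for x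
      using LIMSEQ_INF[of "\<lambda>n. m n x"] by simp
    then show "AE x in lborel. x \<in> {0..l} \<longrightarrow> (\<lambda>n. m n x) \<longlonglongrightarrow> (INF n. a n x)" by simp
  qed (use iug m0 fin in auto)
qed

text \<open>
  Being an upper gradient is a local property of the interval: a bisection argument assembles
  short intervals by the triangle inequality.
\<close>
lemma interval_upper_gradient_local:
  assumes a: "a \<in> borel_measurable borel"
    and loc: "\<And>x. 0 \<le> x \<Longrightarrow> x \<le> l \<Longrightarrow> \<exists>W. open W \<and> x \<in> W \<and>
      (\<forall>s t. 0 \<le> s \<longrightarrow> s \<le> t \<longrightarrow> t \<le> l \<longrightarrow> {s..t} \<subseteq> W \<longrightarrow> increment_le F a s t)"
  shows "interval_upper_gradient l F a"
  unfolding interval_upper_gradient_def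
proof (intro allI impI)
  fix s t assume st: "0 \<le> s" "s \<le> t" "t \<le> l"
  define P where "P c d \<longleftrightarrow> (s \<le> c \<longrightarrow> c \<le> d \<longrightarrow> d \<le> t \<longrightarrow> increment_le F a c d)" for c d
  have "P s t" using st(2)
  proof (induction rule: Bolzano)
    case (trans x y z)
    then show ?case using increment_le_trans[OF a, of x y z F] unfolding P_def by auto
  next
    case (local x)
    obtain W where W: "open W" "x \<in> W"
      "\<And>s t. 0 \<le> s \<Longrightarrow> s \<le> t \<Longrightarrow> t \<le> l \<Longrightarrow> {s..t} \<subseteq> W \<Longrightarrow> increment_le F a s t"
      using loc[of x] local st by auto
    obtain e where e: "e > 0" "ball x e \<subseteq> W" using W by (meson openE)
    have "P c d" if "c \<le> x" "x \<le> d" "d - c < e" for c d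
    proof -
      have "{c..d} \<subseteq> ball x e" using that by (auto simp: dist_real_def)
      then show ?thesis using W(3) e st unfolding P_def by fastforce
    qed
    then show ?case using e by blast
  qed
  then show "increment_le F a s t" using st by (simp add: P_def)
qed

text \<open>
  A function with an integrable upper gradient is absolutely continuous on the interval; continuity
  is what makes the set where one function exceeds another open along the curve.
\<close>
lemma interval_upper_gradient_continuous_on:
  assumes a [measurable]: "a \<in> borel_measurable borel"
    and fin: "(\<integral>\<^sup>+x\<in>{0..l}. a x \<partial>lborel) < \<infinity>"
    and A: "interval_upper_gradient l F a"
  shows "continuous_on {0..l} F"
  unfolding continuous_on_sequentially
proof (intro allI ballI impI, elim conjE)
  fix X x assume x: "x \<in> {0..l}" and X: "\<forall>n. X n \<in> {0..l}" "X \<longlonglongrightarrow> x"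
  define J where "J n = {min (X n) x..max (X n) x}" for n
  have [measurable]: "J n \<in> sets borel" for n by (simp add: J_def)
  have J: "J n \<subseteq> {0..l}" for n using X x unfolding J_def atLeastatMost_subset_iff by (metis atLeastAtMost_iff max.bounded_iff min.bounded_iff)
  have "(\<lambda>n. \<integral>\<^sup>+y\<in>J n. a y \<partial>lborel) \<longlonglongrightarrow> (\<integral>\<^sup>+(y::real). 0 \<partial>lborel)"
  proof (rule nn_integral_dominated_convergence
      [where w = "\<lambda>x. a x * indicator {0..l} x" and u' = "\<lambda>_. 0"])
    show "AE y in lborel. a y * indicator (J j) y \<le> a y * indicator {0..l} y" for j
      using J[of j] by (intro AE_I2 mult_left_mono) (simp_all add: indicator_def subset_iff)
    show "AE y in lborel. (\<lambda>i. a y * indicator (J i) y) \<longlonglongrightarrow> 0"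
      using AE_lborel_singleton[of x]
    proof eventually_elim
      case (elim y)
      then have "0 < dist y x" by simp
      then have "\<forall>\<^sub>F n in sequentially. dist (X n) x < dist y x"
        using X(2) by (auto simp: tendsto_iff)
      moreover have "a y * indicator (J n) y = 0" if "dist (X n) x < dist y x" for n
        using that unfolding J_def dist_real_def
        by (cases "X n \<le> x") (auto simp: indicator_eq_0_iff)
      ultimately have "\<forall>\<^sub>F n in sequentially. a y * indicator (J n) y = 0"
        by (rule eventually_mono)
      then show ?case by (rule tendsto_eventually)
    qed
  qed (use fin in auto)
  moreover have "ennreal \<bar>F (X n) - F x\<bar> \<le> (\<integral>\<^sup>+y\<in>J n. a y \<partial>lborel)" for n
  proof -
    have "increment_le F a (min (X n) x) (max (X n) x)"
      using X x by (intro interval_upper_gradientD[OF A]) (auto simp: min_def max_def)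
    then show ?thesis unfolding increment_le_def J_def
      by (cases "X n \<le> x") (simp_all add: abs_minus_commute)
  qed
  ultimately have "(\<lambda>n. ennreal \<bar>F (X n) - F x\<bar>) \<longlonglongrightarrow> 0"
    by - (rule tendsto_sandwich
      [where f = "\<lambda>_. 0" and h = "\<lambda>n. \<integral>\<^sup>+y\<in>J n. a y \<partial>lborel"], auto)
  then have "(\<lambda>n. \<bar>F (X n) - F x\<bar>) \<longlonglongrightarrow> 0"
    using tendsto_ennreal_iff[of "\<lambda>n. \<bar>F (X n) - F x\<bar>" sequentially 0] by (simp add: ennreal_0)
  then show "(F \<circ> X) \<longlonglongrightarrow> F x"
    by (simp add: tendsto_rabs_zero_iff LIM_zero_iff comp_def)
qed

text \<open>
  Covers the maximum and the positive part of the difference of two functions, whose increments are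
  both dominated by the sum of the increments.
\<close>
lemma interval_upper_gradient_add:
  assumes [measurable]: "a \<in> borel_measurable borel" "b \<in> borel_measurable borel"
    and A: "interval_upper_gradient l F a" and B: "interval_upper_gradient l G b"
    and H: "\<And>s t. \<bar>H t - H s\<bar> \<le> \<bar>F t - F s\<bar> + \<bar>G t - G s\<bar>"
  shows "interval_upper_gradient l H (\<lambda>x. a x + b x)"
  unfolding interval_upper_gradient_def increment_le_def
proof (intro allI impI)
  fix s t assume st: "0 \<le> s" "s \<le> t" "t \<le> l"
  have "ennreal \<bar>H t - H s\<bar> \<le> ennreal \<bar>F t - F s\<bar> + ennreal \<bar>G t - G s\<bar>"
    using H by (simp flip: ennreal_plus add: ennreal_leI)
  also have "\<dots> \<le> (\<integral>\<^sup>+x\<in>{s..t}. a x \<partial>lborel) + (\<integral>\<^sup>+x\<in>{s..t}. b x \<partial>lborel)"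
    using interval_upper_gradientD[OF A st] interval_upper_gradientD[OF B st]
    unfolding increment_le_def by (rule add_mono)
  also have "\<dots> = (\<integral>\<^sup>+x\<in>{s..t}. (a x + b x) \<partial>lborel)"
    by (simp add: distrib_right nn_integral_add)
  finally show "ennreal \<bar>H t - H s\<bar> \<le> (\<integral>\<^sup>+x\<in>{s..t}. (a x + b x) \<partial>lborel)" .
qed

section \<open>Subcurves and integrals along curves\<close>

lemma sum_dist_le_curve_length:
  assumes "mono t" "t 0 = a" "t n = b"
  shows "ennreal (\<Sum>i<n. dist (\<gamma> (t i)) (\<gamma> (t (Suc i)))) \<le> curve_length \<gamma> a b"
  unfolding curve_length_def by (rule SUP_upper2[of "(n, t)"]) (use assms in auto)

lemma curve_length_leI:
  assumes "\<And>n t. mono t \<Longrightarrow> t 0 = a \<Longrightarrow> t n = b \<Longrightarrow>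
      ennreal (\<Sum>i<n. dist (\<gamma> (t i)) (\<gamma> (t (Suc i)))) \<le> c"
  shows "curve_length \<gamma> a b \<le> c"
  unfolding curve_length_def using assms by (auto intro!: SUP_least)

text \<open>
  Any partition of \<open>[0, a]\<close> can be prolonged by the single point \<open>b\<close>, so the length of the curve
  grows by at least \<open>dist (\<gamma> a) (\<gamma> b)\<close> between \<open>a\<close> and \<open>b\<close>.
\<close>
lemma arclength_curve_dist_le:
  assumes \<gamma>: "arclength_curve E \<gamma> l" and ab: "0 \<le> a" "a \<le> b" "b \<le> l"
  shows "dist (\<gamma> a) (\<gamma> b) \<le> b - a"
proof -
  have len: "curve_length \<gamma> 0 a = ennreal a" "curve_length \<gamma> 0 b = ennreal b"
    using \<gamma> ab by (auto simp: arclength_curve_def)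
  have *: "(\<Sum>i<n. dist (\<gamma> (t i)) (\<gamma> (t (Suc i)))) + dist (\<gamma> a) (\<gamma> b) \<le> b"
    if t: "mono t" "t 0 = 0" "t n = a" for n t
  proof -
    define t' where "t' i = (if i \<le> n then t i else b)" for i
    have tn: "t i \<le> a" if "i \<le> n" for i using t that by (auto dest: monoD)
    have "mono t'"
      using t ab tn by (auto simp: mono_def t'_def intro: order_trans)
    then have "ennreal (\<Sum>i<Suc n. dist (\<gamma> (t' i)) (\<gamma> (t' (Suc i)))) \<le> ennreal b"
      unfolding len(2)[symmetric] by (rule sum_dist_le_curve_length) (use t in \<open>auto simp: t'_def\<close>)
    moreover have "(\<Sum>i<Suc n. dist (\<gamma> (t' i)) (\<gamma> (t' (Suc i))))
        = (\<Sum>i<n. dist (\<gamma> (t i)) (\<gamma> (t (Suc i)))) + dist (\<gamma> a) (\<gamma> b)"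
      using t by (auto simp: t'_def intro!: sum.cong)
    ultimately show ?thesis using ab by (auto simp: ennreal_le_iff)
  qed
  define c where "c = b - dist (\<gamma> a) (\<gamma> b)"
  have "0 \<le> c"
  proof -
    have "mono (\<lambda>i::nat. if i = 0 then 0 else a)" using ab by (auto simp: mono_def)
    from *[OF this, of 1] have "dist (\<gamma> 0) (\<gamma> a) + dist (\<gamma> a) (\<gamma> b) \<le> b" by simp
    then show ?thesis using zero_le_dist[of "\<gamma> 0" "\<gamma> a"] unfolding c_def by linarith
  qed
  have "curve_length \<gamma> 0 a \<le> ennreal c"
    by (rule curve_length_leI, rule ennreal_leI) (use * in \<open>auto simp: c_def algebra_simps\<close>)
  then show ?thesis using \<open>0 \<le> c\<close> by (simp add: len ennreal_le_iff c_def)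
qed

text \<open>
  The length of a subcurve on \<open>[s, s + \<tau>]\<close> is at most \<open>\<tau>\<close> because \<open>\<gamma>\<close> is 1-Lipschitz. Conversely,
  moving all points of a partition of \<open>[0, s + \<tau>]\<close> that lie before \<open>s\<close> up to \<open>s\<close> gives a partition of
  the subcurve and loses at most \<open>s\<close> in length, again by the Lipschitz property.
\<close>
lemma arclength_curve_subcurve:
  assumes \<gamma>: "arclength_curve E \<gamma> l" and st: "0 \<le> s" "s < t" "t \<le> l"
  shows "arclength_curve E (\<lambda>x. \<gamma> (s + x)) (t - s)"
  unfolding arclength_curve_def
proof (intro conjI ballI)
  show "0 < t - s" using st by simp
  have cont: "continuous_on {0..l} \<gamma>" and img: "\<gamma> ` {0..l} \<subseteq> E"
    using \<gamma> by (auto simp: arclength_curve_def)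
  show "continuous_on {0..t - s} (\<lambda>x. \<gamma> (s + x))"
    by (rule continuous_on_compose2[OF cont]) (use st in \<open>auto intro!: continuous_intros\<close>)
  show "(\<lambda>x. \<gamma> (s + x)) ` {0..t - s} \<subseteq> E" using img st by fastforce
  fix \<tau> assume \<tau>: "\<tau> \<in> {0..t - s}"
  show "curve_length (\<lambda>x. \<gamma> (s + x)) 0 \<tau> = ennreal \<tau>"
  proof (rule antisym)
    show "curve_length (\<lambda>x. \<gamma> (s + x)) 0 \<tau> \<le> ennreal \<tau>"
    proof (rule curve_length_leI, rule ennreal_leI)
      fix n and u :: "nat \<Rightarrow> real" assume u: "mono u" "u 0 = 0" "u n = \<tau>"
      have "dist (\<gamma> (s + u i)) (\<gamma> (s + u (Suc i))) \<le> u (Suc i) - u i" if "i < n" for i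
      proof -
        have "u 0 \<le> u i" "u i \<le> u (Suc i)" "u (Suc i) \<le> u n" using that by (auto intro!: monoD[OF u(1)])
        then show ?thesis
          using arclength_curve_dist_le[OF \<gamma>, of "s + u i" "s + u (Suc i)"] u st \<tau> by auto
      qed
      then have "(\<Sum>i<n. dist (\<gamma> (s + u i)) (\<gamma> (s + u (Suc i)))) \<le> (\<Sum>i<n. u (Suc i) - u i)"
        by (intro sum_mono) auto
      also have "\<dots> = \<tau>" using u by (simp add: sum_lessThan_telescope)
      finally show "(\<Sum>i<n. dist (\<gamma> (s + u i)) (\<gamma> (s + u (Suc i)))) \<le> \<tau>" .
    qed
  next
    let ?L = "curve_length (\<lambda>x. \<gamma> (s + x)) 0 \<tau>"
    have "curve_length \<gamma> 0 (s + \<tau>) \<le> ?L + ennreal s"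
    proof (rule curve_length_leI)
      fix n and u :: "nat \<Rightarrow> real" assume u: "mono u" "u 0 = 0" "u n = s + \<tau>"
      define v where "v i = max (u i) s - s" for i
      have v: "mono v" "v 0 = 0" "v n = \<tau>"
        using u st \<tau> by (auto simp: v_def mono_def max_def intro: order_trans)
      have step: "dist (\<gamma> (u i)) (\<gamma> (u (Suc i)))
          \<le> dist (\<gamma> (s + v i)) (\<gamma> (s + v (Suc i))) + (min (u (Suc i)) s - min (u i) s)" if "i < n" for i
      proof -
        have o: "0 \<le> u i" "u i \<le> u (Suc i)" "u (Suc i) \<le> l"
          using u that st \<tau> monoD[OF u(1), of 0 i] monoD[OF u(1), of i "Suc i"] monoD[OF u(1), of "Suc i" n] by auto
        consider "u (Suc i) \<le> s" | "u i \<ge> s" | "u i < s" "s < u (Suc i)" by linarith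
        then show ?thesis
        proof cases
          case 1
          then show ?thesis
            using arclength_curve_dist_le[OF \<gamma> o] o by (simp add: v_def)
        next
          case 2
          then show ?thesis using o by (simp add: v_def)
        next
          case 3
          then show ?thesis
            using arclength_curve_dist_le[OF \<gamma>, of "u i" s] o st
              dist_triangle[of "\<gamma> (u i)" "\<gamma> (u (Suc i))" "\<gamma> s"] by (simp add: v_def)
        qed
      qed
      have "(\<Sum>i<n. dist (\<gamma> (u i)) (\<gamma> (u (Suc i))))
          \<le> (\<Sum>i<n. dist (\<gamma> (s + v i)) (\<gamma> (s + v (Suc i))) + (min (u (Suc i)) s - min (u i) s))"
        by (intro sum_mono) (use step in auto)
      also have "\<dots> = (\<Sum>i<n. dist (\<gamma> (s + v i)) (\<gamma> (s + v (Suc i)))) + s"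
        using u \<tau> st sum_lessThan_telescope[of "\<lambda>i. min (u i) s" n] by (simp add: sum.distrib)
      finally have "ennreal (\<Sum>i<n. dist (\<gamma> (u i)) (\<gamma> (u (Suc i))))
          \<le> ennreal ((\<Sum>i<n. dist (\<gamma> (s + v i)) (\<gamma> (s + v (Suc i)))) + s)" by (rule ennreal_leI)
      also have "\<dots> = ennreal (\<Sum>i<n. dist (\<gamma> (s + v i)) (\<gamma> (s + v (Suc i)))) + ennreal s"
        using st by (simp add: sum_nonneg)
      also have "\<dots> \<le> ?L + ennreal s"
        by (intro add_right_mono sum_dist_le_curve_length[where \<gamma> = "\<lambda>x. \<gamma> (s + x)"] v)
      finally show "ennreal (\<Sum>i<n. dist (\<gamma> (u i)) (\<gamma> (u (Suc i)))) \<le> ?L + ennreal s" .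
    qed
    moreover have "curve_length \<gamma> 0 (s + \<tau>) = ennreal \<tau> + ennreal s"
      using \<gamma> st \<tau> by (simp add: arclength_curve_def add.commute)
    ultimately have "ennreal s + ennreal \<tau> \<le> ennreal s + ?L" by (simp add: add.commute)
    then show "ennreal \<tau> \<le> ?L" by (simp add: ennreal_add_left_cancel_le)
  qed
qed

text \<open>
  The curve is frozen outside \<open>[0, l]\<close>, which makes it continuous on the whole line, so that Borel
  functions stay Borel along it.
\<close>
definition along :: "(real \<Rightarrow> 'a) \<Rightarrow> real \<Rightarrow> ('a \<Rightarrow> 'b) \<Rightarrow> real \<Rightarrow> 'b" where
  "along \<gamma> l g x = g (\<gamma> (max 0 (min l x)))"

lemma along_eq: "x \<in> {0..l} \<Longrightarrow> along \<gamma> l g x = g (\<gamma> x)"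
  by (simp add: along_def)

lemma continuous_along:
  assumes "arclength_curve E \<gamma> l"
  shows "continuous_on UNIV (\<lambda>x. \<gamma> (max 0 (min l x)))"
  by (rule continuous_on_compose2[of "{0..l}" \<gamma>])
    (use assms in \<open>auto simp: arclength_curve_def intro!: continuous_intros\<close>)

lemma borel_measurable_along:
  assumes "arclength_curve E \<gamma> l" "g \<in> borel_measurable borel"
  shows "along \<gamma> l g \<in> borel_measurable borel"
  unfolding along_def
  by (rule measurable_compose[OF borel_measurable_continuous_onI[OF continuous_along[OF assms(1)]] assms(2)])

lemma curve_integral_along:
  "curve_integral \<gamma> l g = (\<integral>\<^sup>+x\<in>{0..l}. along \<gamma> l g x \<partial>lborel)"
  unfolding curve_integral_def
  by (intro nn_integral_cong) (simp add: along_eq split: split_indicator)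

lemma curve_integral_mono:
  assumes "\<And>x. x \<in> {0..l} \<Longrightarrow> g (\<gamma> x) \<le> h (\<gamma> x)"
  shows "curve_integral \<gamma> l g \<le> curve_integral \<gamma> l h"
  unfolding curve_integral_def
  by (intro nn_integral_mono) (use assms in \<open>auto split: split_indicator\<close>)

text \<open>
  Integrals over subcurves become integrals over subintervals by translation invariance.
\<close>
lemma curve_integral_subcurve:
  assumes "arclength_curve E \<gamma> l" "g \<in> borel_measurable borel" "0 \<le> s" "s < t" "t \<le> l"
  shows "curve_integral (\<lambda>x. \<gamma> (s + x)) (t - s) g = (\<integral>\<^sup>+x\<in>{s..t}. along \<gamma> l g x \<partial>lborel)"
proof -
  have [measurable]: "along \<gamma> l g \<in> borel_measurable borel"
    using assms by (intro borel_measurable_along)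
  have "(\<integral>\<^sup>+x\<in>{s..t}. along \<gamma> l g x \<partial>lborel)
      = (\<integral>\<^sup>+x. along \<gamma> l g (s + x) * indicator {s..t} (s + x) \<partial>lborel)"
    by (subst nn_integral_real_affine[where c = 1 and t = s]) auto
  also have "\<dots> = curve_integral (\<lambda>x. \<gamma> (s + x)) (t - s) g"
    unfolding curve_integral_def
    by (intro nn_integral_cong) (use assms in \<open>auto simp: along_eq split: split_indicator\<close>)
  finally show ?thesis by simp
qed

section \<open>Spaces with a complete Borel measure and compact balls\<close>

lemma oscillation_ereal: "oscillation (ereal a) (ereal b) = ennreal \<bar>a - b\<bar>"
  by (simp add: oscillation_def)

text \<open>
  Compact closed balls of finite measure make the space \<open>\<sigma>\<close>-finite and turn local
  \<open>p\<close>-integrability into \<open>p\<close>-integrability on compact sets; the theory of upper gradients below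
  rests on these two facts.
\<close>
locale proper_borel_space =
  fixes M :: "'a::metric_space measure" and p :: real
  assumes complete_borel: "complete_borel_measure M"
    and finite_balls: "\<And>x r. 0 < r \<Longrightarrow> emeasure M (ball x r) < \<infinity>"
    and p: "1 < p"
    and proper: "proper_metric TYPE('a)"
begin

lemma space_M [simp]: "space M = UNIV"
proof -
  obtain N where "sets N = sets borel" "M = completion N"
    using complete_borel by (auto simp: complete_borel_measure_def)
  then show ?thesis using sets_eq_imp_space_eq[of N borel] by simp
qed

lemma sets_borel: "A \<in> sets borel \<Longrightarrow> A \<in> sets M"
  using complete_borel by (auto simp: complete_borel_measure_def)

lemma measurable_borel: "f \<in> borel \<rightarrow>\<^sub>M N \<Longrightarrow> f \<in> M \<rightarrow>\<^sub>M N"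
  by (auto simp: measurable_def sets_borel)

lemma open_sets [measurable]: "open U \<Longrightarrow> U \<in> sets M" "closed U \<Longrightarrow> U \<in> sets M"
  by (auto intro: sets_borel)

lemma ball_cball_sets [measurable]: "ball x r \<in> sets M" "cball x r \<in> sets M"
  by (auto intro: open_sets)

lemma compact_cball: "compact (cball (x::'a) r)"
  using proper by (auto simp: proper_metric_def)

lemma sigma_finite: "sigma_finite_measure M"
proof
  define A where "A = range (\<lambda>n::nat. ball (undefined::'a) (real (Suc n)))"
  have "(\<Union>A) = space M"
  proof -
    have "x \<in> \<Union>A" for x
    proof -
      obtain n :: nat where "dist undefined x < real n" using reals_Archimedean2 by blast
      then have "x \<in> ball undefined (real (Suc n))" by simp
      then show ?thesis unfolding A_def by blast
    qed
    then show ?thesis by auto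
  qed
  moreover have "\<forall>a\<in>A. emeasure M a \<noteq> \<infinity>"
    using finite_balls by (auto simp: A_def less_top)
  ultimately show "\<exists>A. countable A \<and> A \<subseteq> sets M \<and> \<Union>A = space M \<and> (\<forall>a\<in>A. emeasure M a \<noteq> \<infinity>)"
    by (intro exI[of _ A]) (auto simp: A_def)
qed

text \<open>
  Enlarging a measurable function to infinity on a Borel null set makes it Borel. Upper gradients and
  the densities that certify exceptional families may always be enlarged, so both can be taken Borel.
\<close>
lemma borel_majorant:
  fixes g :: "'a \<Rightarrow> ennreal"
  assumes "g \<in> borel_measurable M"
  obtains h where "h \<in> borel_measurable borel" "\<And>x. g x \<le> h x" "AE x in M. h x = g x"
proof -
  obtain N where N: "sets N = sets borel" "M = completion N"
    using complete_borel by (auto simp: complete_borel_measure_def)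
  have spN: "space N = UNIV" using sets_eq_imp_space_eq[OF N(1)] by simp
  obtain h where h: "h \<in> borel_measurable N" "AE x in N. g x = h x"
    using completion_ex_borel_measurable[OF assms[unfolded N(2)]] by blast
  obtain Z where Z: "\<And>x. x \<in> space N - Z \<Longrightarrow> g x = h x" "Z \<in> null_sets N"
    using AE_E3[OF h(2)] by metis
  have Zb: "Z \<in> sets borel" using Z(2) N(1) by auto
  have hb [measurable]: "h \<in> borel_measurable borel"
    using h(1) N(1) by (simp cong: measurable_cong_sets)
  show ?thesis
  proof
    show "(\<lambda>x. if x \<in> Z then \<infinity> else h x) \<in> borel_measurable borel" using Zb by measurable
    show "g x \<le> (if x \<in> Z then \<infinity> else h x)" for x using Z(1)[of x] spN by auto
    have "AE x in N. x \<notin> Z" using Z(2) by (rule AE_not_in)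
    then have "AE x in N. (if x \<in> Z then \<infinity> else h x) = g x"
      by eventually_elim (use Z(1) spN in auto)
    then show "AE x in M. (if x \<in> Z then \<infinity> else h x) = g x" unfolding N(2) by (rule AE_completion)
  qed
qed

section \<open>Exceptional families of curves\<close>

lemma almost_every_curveE:
  assumes "almost_every_curve M p P"
  obtains \<rho> where "\<rho> \<in> borel_measurable borel" "(\<integral>\<^sup>+x. epowr (\<rho> x) p \<partial>M) < \<infinity>"
    "\<And>\<gamma> l. arclength_curve UNIV \<gamma> l \<Longrightarrow> \<not> P \<gamma> l \<Longrightarrow> curve_integral \<gamma> l \<rho> = \<infinity>"
proof -
  obtain \<rho> where \<rho>: "\<rho> \<in> borel_measurable M" "(\<integral>\<^sup>+x. epowr (\<rho> x) p \<partial>M) < \<infinity>"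
    "\<And>\<gamma> l. arclength_curve UNIV \<gamma> l \<Longrightarrow> \<not> P \<gamma> l \<Longrightarrow> curve_integral \<gamma> l \<rho> = \<infinity>"
    using assms unfolding almost_every_curve_def by auto
  obtain h where h: "h \<in> borel_measurable borel" "\<And>x. \<rho> x \<le> h x" "AE x in M. h x = \<rho> x"
    using borel_majorant[OF \<rho>(1)] by blast
  have "(\<integral>\<^sup>+x. epowr (h x) p \<partial>M) = (\<integral>\<^sup>+x. epowr (\<rho> x) p \<partial>M)"
    by (rule nn_integral_cong_AE) (use h(3) in \<open>eventually_elim, simp\<close>)
  moreover have "curve_integral \<gamma> l h = \<infinity>" if "arclength_curve UNIV \<gamma> l" "\<not> P \<gamma> l" for \<gamma> l
    using \<rho>(3)[OF that] curve_integral_mono[of l \<rho> \<gamma> h] h(2) by (simp add: top_unique)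
  ultimately show ?thesis using that h(1) \<rho>(2) by auto
qed

lemma almost_every_curveI:
  assumes "\<rho> \<in> borel_measurable M" "(\<integral>\<^sup>+x. epowr (\<rho> x) p \<partial>M) < \<infinity>"
    "\<And>\<gamma> l. arclength_curve UNIV \<gamma> l \<Longrightarrow> \<not> P \<gamma> l \<Longrightarrow> curve_integral \<gamma> l \<rho> = \<infinity>"
  shows "almost_every_curve M p P"
  unfolding almost_every_curve_def using assms by auto

lemma almost_every_curve_mono:
  assumes "almost_every_curve M p P" "\<And>\<gamma> l. arclength_curve UNIV \<gamma> l \<Longrightarrow> P \<gamma> l \<Longrightarrow> Q \<gamma> l"
  shows "almost_every_curve M p Q"
  using assms unfolding almost_every_curve_def by simp blast

text \<open>
  Countably many exceptional families are certified by one density, the supremum of suitable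
  multiples of the given ones. A supremum is preferable to a sum since its \<open>p\<close>-th power is
  trivially bounded by the sum of the \<open>p\<close>-th powers.
\<close>
lemma almost_every_curve_all_nat:
  fixes P :: "nat \<Rightarrow> (real \<Rightarrow> 'a) \<Rightarrow> real \<Rightarrow> bool"
  assumes "\<And>n. almost_every_curve M p (P n)"
  shows "almost_every_curve M p (\<lambda>\<gamma> l. \<forall>n. P n \<gamma> l)"
proof -
  have "\<exists>\<rho>. \<rho> \<in> borel_measurable borel \<and> (\<integral>\<^sup>+x. epowr (\<rho> x) p \<partial>M) < \<infinity> \<and>
      (\<forall>\<gamma> l. arclength_curve UNIV \<gamma> l \<longrightarrow> \<not> P n \<gamma> l \<longrightarrow> curve_integral \<gamma> l \<rho> = \<infinity>)" for n
    using almost_every_curveE[OF assms[of n]] by metis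
  then obtain \<rho> where \<rho> [measurable]: "\<And>n. \<rho> n \<in> borel_measurable borel"
    and fin: "\<And>n. (\<integral>\<^sup>+x. epowr (\<rho> n x) p \<partial>M) < \<infinity>"
    and bad: "\<And>n \<gamma> l. arclength_curve UNIV \<gamma> l \<Longrightarrow> \<not> P n \<gamma> l \<Longrightarrow> curve_integral \<gamma> l (\<rho> n) = \<infinity>"
    by metis
  have [measurable]: "\<rho> n \<in> borel_measurable M" for n by (intro measurable_borel \<rho>)
  define I where "I n = enn2real (\<integral>\<^sup>+x. epowr (\<rho> n x) p \<partial>M)" for n
  have I: "(\<integral>\<^sup>+x. epowr (\<rho> n x) p \<partial>M) = ennreal (I n)" "0 \<le> I n" for n
    using fin[of n] by (auto simp: I_def)
  \<comment> \<open>The weights are chosen such that the \<open>n\<close>-th term contributes at most \<open>1 / 2 ^ n\<close>.\<close>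
  define c where "c n = (1 / (2 ^ n * (1 + I n))) powr (1 / p)" for n
  have c: "c n > 0" "c n powr p = 1 / (2 ^ n * (1 + I n))" for n
  proof -
    have "1 + I n > 0" using I(2)[of n] by linarith
    then have "1 / (2 ^ n * (1 + I n)) > 0" by simp
    then show "c n > 0" "c n powr p = 1 / (2 ^ n * (1 + I n))"
      using p \<open>1 + I n > 0\<close> unfolding c_def by (simp_all add: powr_powr)
  qed
  define \<sigma> where "\<sigma> x = (SUP n. ennreal (c n) * \<rho> n x)" for x
  show ?thesis
  proof (rule almost_every_curveI)
    show "\<sigma> \<in> borel_measurable M" unfolding \<sigma>_def by measurable
    have "(\<integral>\<^sup>+x. epowr (\<sigma> x) p \<partial>M) \<le> (\<integral>\<^sup>+x. (\<Sum>n. ennreal (c n powr p) * epowr (\<rho> n x) p) \<partial>M)"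
      unfolding \<sigma>_def
    proof (intro nn_integral_mono epowr_SUP_le)
      fix x n
      show "epowr (ennreal (c n) * \<rho> n x) p \<le> (\<Sum>n. ennreal (c n powr p) * epowr (\<rho> n x) p)"
        using sum_le_suminf[OF summableI, of "{n}" "\<lambda>n. ennreal (c n powr p) * epowr (\<rho> n x) p"]
          c(1)[of n] by (simp add: epowr_mult less_imp_le)
    qed (use p in auto)
    also have "\<dots> = (\<Sum>n. ennreal (c n powr p) * ennreal (I n))"
      by (simp add: nn_integral_suminf nn_integral_cmult I)
    also have "\<dots> \<le> (\<Sum>n. ennreal ((1 / 2) ^ n))"
    proof (intro suminf_le summableI)
      fix n
      have "I n / (1 + I n) \<le> 1" using I(2)[of n] by simp
      then have "I n / (1 + I n) / 2 ^ n \<le> 1 / 2 ^ n" by (intro divide_right_mono) auto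
      then have "c n powr p * I n \<le> (1 / 2) ^ n"
        unfolding c(2) by (simp add: power_divide mult.commute)
      then show "ennreal (c n powr p) * ennreal (I n) \<le> ennreal ((1 / 2) ^ n)"
        using I(2) by (auto simp flip: ennreal_mult intro!: ennreal_leI)
    qed
    also have "\<dots> = ennreal 2"
      using geometric_sums[of "1 / 2 :: real"] by (intro suminf_ennreal_eq) auto
    finally show "(\<integral>\<^sup>+x. epowr (\<sigma> x) p \<partial>M) < \<infinity>" by (simp add: le_less_trans)
  next
    fix \<gamma> l assume \<gamma>: "arclength_curve UNIV \<gamma> l" and "\<not> (\<forall>n. P n \<gamma> l)"
    then obtain n where "\<not> P n \<gamma> l" by blast
    then have inf: "curve_integral \<gamma> l (\<rho> n) = \<infinity>" using bad \<gamma> by blast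
    have [measurable]: "along \<gamma> l (\<rho> n) \<in> borel_measurable borel"
      by (rule borel_measurable_along[OF \<gamma> \<rho>])
    have "\<infinity> = ennreal (c n) * curve_integral \<gamma> l (\<rho> n)"
      using c(1)[of n] unfolding inf by (simp add: ennreal_mult_top)
    also have "\<dots> = (\<integral>\<^sup>+x\<in>{0..l}. (ennreal (c n) * along \<gamma> l (\<rho> n) x) \<partial>lborel)"
      unfolding curve_integral_along by (subst nn_integral_cmult[symmetric]) (auto simp: mult.assoc)
    also have "\<dots> = curve_integral \<gamma> l (\<lambda>x. ennreal (c n) * \<rho> n x)"
      unfolding curve_integral_along by (simp add: along_def)
    also have "\<dots> \<le> curve_integral \<gamma> l \<sigma>"
      unfolding \<sigma>_def by (intro curve_integral_mono SUP_upper) auto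
    finally show "curve_integral \<gamma> l \<sigma> = \<infinity>" by (simp add: top_unique)
  qed
qed

lemma almost_every_curve_ball:
  assumes "countable I" "\<And>i. i \<in> I \<Longrightarrow> almost_every_curve M p (P i)"
  shows "almost_every_curve M p (\<lambda>\<gamma> l. \<forall>i\<in>I. P i \<gamma> l)"
proof (cases "I = {}")
  case True
  show ?thesis
    by (rule almost_every_curveI[where \<rho> = "\<lambda>_. 0"]) (use True in auto)
next
  case False
  have "almost_every_curve M p (\<lambda>\<gamma> l. \<forall>n. P (from_nat_into I n) \<gamma> l)"
    by (intro almost_every_curve_all_nat assms(2) from_nat_into False)
  then show ?thesis
    by (rule almost_every_curve_mono) (metis assms(1) from_nat_into_surj)
qed

lemma almost_every_curve_conj:
  assumes "almost_every_curve M p P" "almost_every_curve M p Q"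
  shows "almost_every_curve M p (\<lambda>\<gamma> l. P \<gamma> l \<and> Q \<gamma> l)"
proof -
  have "almost_every_curve M p (\<lambda>\<gamma> l. \<forall>b\<in>UNIV. (if b then P else Q) \<gamma> l)"
    by (intro almost_every_curve_ball) (use assms in auto)
  then show ?thesis by (rule almost_every_curve_mono) (auto split: if_splits)
qed

text \<open>
  A density with infinite integral over a subcurve has infinite integral over the whole curve.
\<close>
lemma almost_every_curve_subcurves:
  assumes "almost_every_curve M p P"
  shows "almost_every_curve M p
    (\<lambda>\<gamma> l. \<forall>s t. 0 \<le> s \<longrightarrow> s < t \<longrightarrow> t \<le> l \<longrightarrow> P (\<lambda>x. \<gamma> (s + x)) (t - s))"
proof -
  obtain \<rho> where \<rho>: "\<rho> \<in> borel_measurable borel" "(\<integral>\<^sup>+x. epowr (\<rho> x) p \<partial>M) < \<infinity>"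
    "\<And>\<gamma> l. arclength_curve UNIV \<gamma> l \<Longrightarrow> \<not> P \<gamma> l \<Longrightarrow> curve_integral \<gamma> l \<rho> = \<infinity>"
    using almost_every_curveE[OF assms] by blast
  show ?thesis
  proof (rule almost_every_curveI[OF measurable_borel[OF \<rho>(1)] \<rho>(2)])
    fix \<gamma> l assume \<gamma>: "arclength_curve UNIV \<gamma> l"
      and "\<not> (\<forall>s t. 0 \<le> s \<longrightarrow> s < t \<longrightarrow> t \<le> l \<longrightarrow> P (\<lambda>x. \<gamma> (s + x)) (t - s))"
    then obtain s t where st: "0 \<le> s" "s < t" "t \<le> l" "\<not> P (\<lambda>x. \<gamma> (s + x)) (t - s)" by blast
    have "\<infinity> = curve_integral (\<lambda>x. \<gamma> (s + x)) (t - s) \<rho>"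
      using \<rho>(3)[OF arclength_curve_subcurve[OF \<gamma> st(1-3)] st(4)] by simp
    also have "\<dots> = (\<integral>\<^sup>+x\<in>{s..t}. along \<gamma> l \<rho> x \<partial>lborel)"
      by (rule curve_integral_subcurve[OF \<gamma> \<rho>(1) st(1-3)])
    also have "\<dots> \<le> curve_integral \<gamma> l \<rho>"
      unfolding curve_integral_along
      by (intro nn_integral_mono) (use st in \<open>auto split: split_indicator\<close>)
    finally show "curve_integral \<gamma> l \<rho> = \<infinity>" by (simp add: top_unique)
  qed
qed

text \<open>
  Extending the certifying density by zero does not change its integral over curves inside \<open>B\<close>.
\<close>
lemma almost_every_curve_restrict:
  assumes B [measurable]: "B \<in> sets M" and P: "almost_every_curve (restrict_space M B) p P"
  shows "almost_every_curve M p (\<lambda>\<gamma> l. \<gamma> ` {0..l} \<subseteq> B \<longrightarrow> P \<gamma> l)"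
proof -
  obtain \<rho> where \<rho>: "\<rho> \<in> borel_measurable (restrict_space M B)"
    "(\<integral>\<^sup>+x. epowr (\<rho> x) p \<partial>restrict_space M B) < \<infinity>"
    "\<And>\<gamma> l. arclength_curve B \<gamma> l \<Longrightarrow> \<not> P \<gamma> l \<Longrightarrow> curve_integral \<gamma> l \<rho> = \<infinity>"
    using P unfolding almost_every_curve_def by (auto simp: space_restrict_space)
  show ?thesis
  proof (rule almost_every_curveI)
    show "(\<lambda>x. \<rho> x * indicator B x) \<in> borel_measurable M"
      using \<rho>(1) by (subst (asm) borel_measurable_restrict_space_iff_ennreal) auto
    have "(\<integral>\<^sup>+x. epowr (\<rho> x * indicator B x) p \<partial>M) = (\<integral>\<^sup>+x. epowr (\<rho> x) p \<partial>restrict_space M B)"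
      by (subst nn_integral_restrict_space) (auto intro!: nn_integral_cong split: split_indicator)
    then show "(\<integral>\<^sup>+x. epowr (\<rho> x * indicator B x) p \<partial>M) < \<infinity>" using \<rho>(2) by simp
    fix \<gamma> l assume \<gamma>: "arclength_curve UNIV \<gamma> l" "\<not> (\<gamma> ` {0..l} \<subseteq> B \<longrightarrow> P \<gamma> l)"
    then have "curve_integral \<gamma> l \<rho> = \<infinity>" by (intro \<rho>(3)) (auto simp: arclength_curve_def)
    moreover have "curve_integral \<gamma> l \<rho> \<le> curve_integral \<gamma> l (\<lambda>x. \<rho> x * indicator B x)"
    proof (rule curve_integral_mono)
      fix x assume "x \<in> {0..l}"
      then have "\<gamma> x \<in> B" using \<gamma> by blast
      then show "\<rho> (\<gamma> x) \<le> \<rho> (\<gamma> x) * indicator B (\<gamma> x)" by simp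
    qed
    ultimately show "curve_integral \<gamma> l (\<lambda>x. \<rho> x * indicator B x) = \<infinity>" by (simp add: top_unique)
  qed
qed

section \<open>Local integrability\<close>

lemma Lp_loc_compact:
  assumes g: "Lp_loc M p g" and K: "compact K"
  shows "(\<integral>\<^sup>+x\<in>K. epowr (g x) p \<partial>M) < \<infinity>"
proof -
  have [measurable]: "g \<in> borel_measurable M" using g by (auto simp: Lp_loc_def)
  have "\<forall>x. \<exists>r>0. (\<integral>\<^sup>+y\<in>ball x r. epowr (g y) p \<partial>M) < \<infinity>" using g by (auto simp: Lp_loc_def)
  then obtain r where r: "\<And>x. r x > 0" "\<And>x. (\<integral>\<^sup>+y\<in>ball x (r x). epowr (g y) p \<partial>M) < \<infinity>" by metis
  have "K \<subseteq> (\<Union>x\<in>K. ball x (r x))" using r(1) by auto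
  then obtain T where T: "T \<subseteq> K" "finite T" "K \<subseteq> (\<Union>x\<in>T. ball x (r x))"
    using compactE_image[OF K, of K "\<lambda>x. ball x (r x)"] by auto
  have "(\<integral>\<^sup>+x\<in>K. epowr (g x) p \<partial>M) \<le> (\<integral>\<^sup>+y. (\<Sum>x\<in>T. epowr (g y) p * indicator (ball x (r x)) y) \<partial>M)"
  proof (rule nn_integral_mono)
    fix y
    show "epowr (g y) p * indicator K y \<le> (\<Sum>x\<in>T. epowr (g y) p * indicator (ball x (r x)) y)"
    proof (cases "y \<in> K")
      case True
      then obtain x where "x \<in> T" "y \<in> ball x (r x)" using T by auto
      then show ?thesis using True
        member_le_sum[of x T "\<lambda>x. epowr (g y) p * indicator (ball x (r x)) y"] T(2) by simp
    qed simp
  qed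
  also have "\<dots> = (\<Sum>x\<in>T. (\<integral>\<^sup>+y\<in>ball x (r x). epowr (g y) p \<partial>M))"
    by (rule nn_integral_sum) measurable
  also have "\<dots> < \<infinity>" using r(2) T(2) by (simp add: less_top)
  finally show ?thesis .
qed

lemma Lp_loc_cong_AE:
  assumes "Lp_loc M p g" "h \<in> borel_measurable M" "AE x in M. h x = g x"
  shows "Lp_loc M p h"
proof -
  have "(\<integral>\<^sup>+y\<in>A. epowr (h y) p \<partial>M) = (\<integral>\<^sup>+y\<in>A. epowr (g y) p \<partial>M)" for A
    by (rule nn_integral_cong_AE) (use assms(3) in \<open>eventually_elim, simp\<close>)
  then show ?thesis using assms(1,2) by (simp add: Lp_loc_def)
qed

lemma Lp_loc_mono:
  assumes "Lp_loc M p g" "h \<in> borel_measurable M" "\<And>x. h x \<le> g x"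
  shows "Lp_loc M p h"
proof -
  have "(\<integral>\<^sup>+y\<in>A. epowr (h y) p \<partial>M) \<le> (\<integral>\<^sup>+y\<in>A. epowr (g y) p \<partial>M)" for A
    by (intro nn_integral_mono mult_right_mono epowr_mono assms(3)) (use p in auto)
  then show ?thesis using assms(1,2) unfolding Lp_loc_def by (meson le_less_trans)
qed

lemma Lp_loc_add:
  assumes "Lp_loc M p g" "Lp_loc M p h"
  shows "Lp_loc M p (\<lambda>x. g x + h x)"
proof -
  have [measurable]: "g \<in> borel_measurable M" "h \<in> borel_measurable M"
    using assms by (auto simp: Lp_loc_def)
  have "(\<integral>\<^sup>+y\<in>ball x 1. epowr (g y + h y) p \<partial>M) < \<infinity>" for x
  proof -
    have "(\<integral>\<^sup>+y\<in>ball x 1. epowr (g y + h y) p \<partial>M)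
        \<le> (\<integral>\<^sup>+y. ennreal (2 powr p) *
             (epowr (g y) p * indicator (cball x 1) y + epowr (h y) p * indicator (cball x 1) y) \<partial>M)"
      using p by (intro nn_integral_mono) (auto split: split_indicator intro: epowr_add_le)
    also have "\<dots> = ennreal (2 powr p) *
        ((\<integral>\<^sup>+y\<in>cball x 1. epowr (g y) p \<partial>M) + (\<integral>\<^sup>+y\<in>cball x 1. epowr (h y) p \<partial>M))"
      by (simp add: nn_integral_cmult nn_integral_add)
    also have "\<dots> < \<infinity>"
      using assms[THEN Lp_loc_compact, OF compact_cball]
      by (simp add: ennreal_mult_less_top)
    finally show ?thesis .
  qed
  then show ?thesis unfolding Lp_loc_def by (auto intro!: exI[of _ 1])
qed

lemma Lp_loc_const: "Lp_loc M p (\<lambda>_. ennreal c)"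
proof -
  have "(\<integral>\<^sup>+y\<in>ball x 1. epowr (ennreal c) p \<partial>M) < \<infinity>" for x
    using finite_balls[of 1 x]
    by (simp add: nn_integral_cmult_indicator ennreal_mult_less_top epowr_def)
  then show ?thesis unfolding Lp_loc_def by (auto intro!: exI[of _ 1])
qed

text \<open>
  On a fixed ball \<open>g\<close> itself certifies the curves with infinite integral, and every curve is
  bounded, so countably many balls suffice.
\<close>
lemma almost_every_curve_integral_finite:
  assumes g: "Lp_loc M p g" and gb: "g \<in> borel_measurable borel"
  shows "almost_every_curve M p (\<lambda>\<gamma> l. (\<integral>\<^sup>+x\<in>{0..l}. along \<gamma> l g x \<partial>lborel) < \<infinity>)"
proof -
  have [measurable]: "g \<in> borel_measurable M" by (rule measurable_borel[OF gb])
  define B where "B n = ball (undefined::'a) (real n)" for n :: nat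
  have "almost_every_curve M p (\<lambda>\<gamma> l. \<forall>n. \<gamma> ` {0..l} \<subseteq> B n \<longrightarrow> curve_integral \<gamma> l g < \<infinity>)"
  proof (rule almost_every_curve_all_nat)
    fix n
    show "almost_every_curve M p (\<lambda>\<gamma> l. \<gamma> ` {0..l} \<subseteq> B n \<longrightarrow> curve_integral \<gamma> l g < \<infinity>)"
    proof (rule almost_every_curveI)
      show "(\<lambda>x. g x * indicator (B n) x) \<in> borel_measurable M" unfolding B_def by measurable
      have "(\<integral>\<^sup>+x. epowr (g x * indicator (B n) x) p \<partial>M)
          \<le> (\<integral>\<^sup>+x\<in>cball undefined (real n). epowr (g x) p \<partial>M)"
        by (intro nn_integral_mono) (auto simp: B_def split: split_indicator)
      also have "\<dots> < \<infinity>" by (rule Lp_loc_compact[OF g compact_cball])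
      finally show "(\<integral>\<^sup>+x. epowr (g x * indicator (B n) x) p \<partial>M) < \<infinity>" .
      fix \<gamma> l assume \<gamma>: "arclength_curve UNIV \<gamma> l" "\<not> (\<gamma> ` {0..l} \<subseteq> B n \<longrightarrow> curve_integral \<gamma> l g < \<infinity>)"
      then have "curve_integral \<gamma> l g = \<infinity>" by (metis infinity_ennreal_def less_top)
      moreover have "curve_integral \<gamma> l g \<le> curve_integral \<gamma> l (\<lambda>x. g x * indicator (B n) x)"
      proof (rule curve_integral_mono)
        fix x assume "x \<in> {0..l}"
        then have "\<gamma> x \<in> B n" using \<gamma> by blast
        then show "g (\<gamma> x) \<le> g (\<gamma> x) * indicator (B n) (\<gamma> x)" by simp
      qed
      ultimately show "curve_integral \<gamma> l (\<lambda>x. g x * indicator (B n) x) = \<infinity>" by (simp add: top_unique)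
    qed
  qed
  then show ?thesis
  proof (rule almost_every_curve_mono)
    fix \<gamma> l assume \<gamma>: "arclength_curve UNIV \<gamma> l"
      and fin: "\<forall>n. \<gamma> ` {0..l} \<subseteq> B n \<longrightarrow> curve_integral \<gamma> l g < \<infinity>"
    have "compact (\<gamma> ` {0..l})"
      using \<gamma> by (intro compact_continuous_image) (auto simp: arclength_curve_def)
    then have "bounded (\<gamma> ` {0..l})" by (rule compact_imp_bounded)
    then obtain e where e: "\<And>y. y \<in> \<gamma> ` {0..l} \<Longrightarrow> dist undefined y \<le> e"
      using bounded_any_center[of _ undefined] by metis
    obtain n :: nat where "e < real n" using reals_Archimedean2 by blast
    then have "\<gamma> ` {0..l} \<subseteq> B n" unfolding B_def by (meson e le_less_trans mem_ball subsetI)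
    then show "(\<integral>\<^sup>+x\<in>{0..l}. along \<gamma> l g x \<partial>lborel) < \<infinity>"
      using fin unfolding curve_integral_along by blast
  qed
qed

section \<open>Weak upper gradients\<close>

abbreviation upper_gradient_along :: "('a \<Rightarrow> real) \<Rightarrow> ('a \<Rightarrow> ennreal) \<Rightarrow> (real \<Rightarrow> 'a) \<Rightarrow> real \<Rightarrow> bool" where
  "upper_gradient_along f g \<gamma> l \<equiv> interval_upper_gradient l (along \<gamma> l f) (along \<gamma> l g)"

lemma weak_upper_gradientI_along:
  assumes g: "g \<in> borel_measurable M" and "almost_every_curve M p (upper_gradient_along f g)"
  shows "weak_upper_gradient M p (\<lambda>x. ereal (f x)) g"
proof -
  have "almost_every_curve M p
      (\<lambda>\<gamma> l. oscillation (ereal (f (\<gamma> 0))) (ereal (f (\<gamma> l))) \<le> curve_integral \<gamma> l g)"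
    using assms(2)
  proof (rule almost_every_curve_mono)
    fix \<gamma> l assume \<gamma>: "arclength_curve UNIV \<gamma> l" and "upper_gradient_along f g \<gamma> l"
    then have "increment_le (along \<gamma> l f) (along \<gamma> l g) 0 l"
      by (intro interval_upper_gradientD) (auto simp: arclength_curve_def)
    then show "oscillation (ereal (f (\<gamma> 0))) (ereal (f (\<gamma> l))) \<le> curve_integral \<gamma> l g"
      using \<gamma> by (simp add: increment_le_def along_eq oscillation_ereal curve_integral_along
          abs_minus_commute arclength_curve_def)
  qed
  then show "weak_upper_gradient M p (\<lambda>x. ereal (f x)) g"
    unfolding weak_upper_gradient_def using g by simp
qed

text \<open>
  Weak upper gradients only constrain the end points of curves. As almost every curve has no
  exceptional subcurve, the inequality automatically holds on all subintervals.
\<close>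
lemma weak_upper_gradient_iff_along:
  assumes g: "g \<in> borel_measurable borel"
  shows "weak_upper_gradient M p (\<lambda>x. ereal (f x)) g \<longleftrightarrow> almost_every_curve M p (upper_gradient_along f g)"
proof
  assume "weak_upper_gradient M p (\<lambda>x. ereal (f x)) g"
  then have "almost_every_curve M p (\<lambda>\<gamma> l. ennreal \<bar>f (\<gamma> 0) - f (\<gamma> l)\<bar> \<le> curve_integral \<gamma> l g)"
    by (simp add: weak_upper_gradient_def oscillation_ereal)
  from almost_every_curve_subcurves[OF this]
  show "almost_every_curve M p (upper_gradient_along f g)"
  proof (rule almost_every_curve_mono)
    fix \<gamma> l assume \<gamma>: "arclength_curve UNIV \<gamma> l"
      and sub: "\<forall>s t. 0 \<le> s \<longrightarrow> s < t \<longrightarrow> t \<le> l \<longrightarrow>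
        ennreal \<bar>f (\<gamma> (s + 0)) - f (\<gamma> (s + (t - s)))\<bar> \<le> curve_integral (\<lambda>x. \<gamma> (s + x)) (t - s) g"
    show "upper_gradient_along f g \<gamma> l"
      unfolding interval_upper_gradient_def
    proof (intro allI impI)
      fix s t assume st: "0 \<le> s" "s \<le> t" "t \<le> l"
      show "increment_le (along \<gamma> l f) (along \<gamma> l g) s t"
      proof (cases "s = t")
        case False
        with st have "s < t" by simp
        then have "ennreal \<bar>f (\<gamma> s) - f (\<gamma> t)\<bar> \<le> (\<integral>\<^sup>+x\<in>{s..t}. along \<gamma> l g x \<partial>lborel)"
          using sub[rule_format, of s t] st curve_integral_subcurve[OF \<gamma> g, of s t] by simp
        then show ?thesis using st by (simp add: increment_le_def along_eq abs_minus_commute)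
      qed (simp add: increment_le_def)
    qed
  qed
qed (rule weak_upper_gradientI_along[OF measurable_borel[OF g]])

lemma weak_upper_gradient_mono:
  assumes "weak_upper_gradient M p f g" "h \<in> borel_measurable M" "\<And>x. g x \<le> h x"
  shows "weak_upper_gradient M p f h"
  unfolding weak_upper_gradient_def
proof
  have "almost_every_curve M p (\<lambda>\<gamma> l. oscillation (f (\<gamma> 0)) (f (\<gamma> l)) \<le> curve_integral \<gamma> l g)"
    using assms(1) by (simp add: weak_upper_gradient_def)
  then show "almost_every_curve M p (\<lambda>\<gamma> l. oscillation (f (\<gamma> 0)) (f (\<gamma> l)) \<le> curve_integral \<gamma> l h)"
    by (rule almost_every_curve_mono) (meson assms(3) curve_integral_mono order_trans)
qed (rule assms(2))

text \<open>
  Borel representatives compose measurably with every curve.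
\<close>
definition borel_upper_gradient :: "('a \<Rightarrow> real) \<Rightarrow> ('a \<Rightarrow> ennreal) \<Rightarrow> bool" where
  "borel_upper_gradient f g \<longleftrightarrow>
     g \<in> borel_measurable borel \<and> Lp_loc M p g \<and> weak_upper_gradient M p (\<lambda>x. ereal (f x)) g"

lemma borel_upper_gradient_majorant:
  assumes "weak_upper_gradient M p (\<lambda>x. ereal (f x)) g" "Lp_loc M p g"
  obtains h where "borel_upper_gradient f h" "AE x in M. h x = g x"
proof -
  have "g \<in> borel_measurable M" using assms(2) by (simp add: Lp_loc_def)
  then obtain h where h: "h \<in> borel_measurable borel" "\<And>x. g x \<le> h x" "AE x in M. h x = g x"
    using borel_majorant by blast
  have "borel_upper_gradient f h"
    unfolding borel_upper_gradient_def
    using h weak_upper_gradient_mono[OF assms(1) measurable_borel[OF h(1)] h(2)]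
      Lp_loc_cong_AE[OF assms(2) measurable_borel[OF h(1)] h(3)] by blast
  then show ?thesis using h(3) that by blast
qed

lemma borel_upper_gradient_along:
  assumes "borel_upper_gradient f g"
  shows "almost_every_curve M p (\<lambda>\<gamma> l.
    upper_gradient_along f g \<gamma> l \<and> (\<integral>\<^sup>+x\<in>{0..l}. along \<gamma> l g x \<partial>lborel) < \<infinity>)"
  using assms almost_every_curve_integral_finite weak_upper_gradient_iff_along
  by (intro almost_every_curve_conj) (auto simp: borel_upper_gradient_def)

text \<open>
  The lattice property behind the existence of minimal weak upper gradients. Local integrability
  makes the integrals along almost every curve finite, as dominated convergence requires.
\<close>
lemma borel_upper_gradient_INF:
  fixes g :: "nat \<Rightarrow> 'a \<Rightarrow> ennreal"
  assumes g: "\<And>n. borel_upper_gradient f (g n)"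
  shows "borel_upper_gradient f (\<lambda>x. INF n. g n x)"
proof -
  have gb [measurable]: "g n \<in> borel_measurable borel" for n
    using g by (simp add: borel_upper_gradient_def)
  have h [measurable]: "(\<lambda>x. INF n. g n x) \<in> borel_measurable borel" by measurable
  have "almost_every_curve M p (\<lambda>\<gamma> l. \<forall>n. upper_gradient_along f (g n) \<gamma> l \<and>
      (\<integral>\<^sup>+x\<in>{0..l}. along \<gamma> l (g n) x \<partial>lborel) < \<infinity>)"
    by (intro almost_every_curve_all_nat borel_upper_gradient_along g)
  then have "almost_every_curve M p (upper_gradient_along f (\<lambda>x. INF n. g n x))"
  proof (rule almost_every_curve_mono)
    fix \<gamma> l assume \<gamma>: "arclength_curve UNIV \<gamma> l"
      and *: "\<forall>n. upper_gradient_along f (g n) \<gamma> l \<and> (\<integral>\<^sup>+x\<in>{0..l}. along \<gamma> l (g n) x \<partial>lborel) < \<infinity>"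
    have "interval_upper_gradient l (along \<gamma> l f) (\<lambda>x. INF n. along \<gamma> l (g n) x)"
      by (rule interval_upper_gradient_INF) (use * borel_measurable_along[OF \<gamma> gb] in auto)
    then show "upper_gradient_along f (\<lambda>x. INF n. g n x) \<gamma> l" by (simp add: along_def[abs_def])
  qed
  moreover have "Lp_loc M p (\<lambda>x. INF n. g n x)"
  proof (rule Lp_loc_mono)
    show "Lp_loc M p (g 0)" using g by (simp add: borel_upper_gradient_def)
    show "(INF n. g n x) \<le> g 0 x" for x by (rule INF_lower) simp
  qed (rule measurable_borel[OF h])
  ultimately show ?thesis
    unfolding borel_upper_gradient_def using h weak_upper_gradient_iff_along[OF h] by blast
qed

text \<open>
  A smallest upper gradient is obtained by maximizing \<open>J g = \<integral> \<theta> / (1 + g)\<close> for a positive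
  integrable weight \<open>\<theta>\<close>. The infimum \<open>h\<close> of a maximizing sequence is an upper gradient and attains
  the maximum. For a competitor \<open>k\<close>, the minimum of \<open>h\<close> and \<open>k\<close> is again an upper gradient; its \<open>J\<close> is
  at least that of \<open>h\<close>, hence equal to it by maximality, so the minimum is \<open>h\<close> almost everywhere.
\<close>
lemma minimal_weak_upper_gradient:
  assumes g0: "weak_upper_gradient M p (\<lambda>x. ereal (f x)) g0" "Lp_loc M p g0"
  shows "is_minimal_weak_upper_gradient M p (\<lambda>x. ereal (f x))
    (minimal_weak_upper_gradient M p (\<lambda>x. ereal (f x)))"
proof -
  obtain \<theta> :: "'a \<Rightarrow> real" where \<theta>: "\<theta> \<in> borel_measurable M" "\<And>x. \<theta> x > 0" "integrable M \<theta>"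
    using sigma_finite_measure.obtain_positive_integrable_function[OF sigma_finite] by metis
  note [measurable] = \<theta>(1)
  define J where "J g = (\<integral>\<^sup>+x. ennreal (\<theta> x) * inverse (1 + g x) \<partial>M)" for g
  define \<G> where "\<G> = {g. borel_upper_gradient f g}"
  have "\<G> \<noteq> {}" using borel_upper_gradient_majorant[OF g0] unfolding \<G>_def by blast
  then obtain j where j: "range j \<subseteq> J ` \<G>" "(SUP g\<in>\<G>. J g) = (SUP n::nat. j n)"
    using ennreal_SUP_countable_SUP[of \<G> J] by auto
  then have "\<forall>n. \<exists>g\<in>\<G>. j n = J g" by blast
  then obtain g where g: "\<And>n. g n \<in> \<G>" "\<And>n. j n = J (g n)" by metis
  define h where "h x = (INF n. g n x)" for x
  have h: "h \<in> \<G>" using borel_upper_gradient_INF[of f g] g unfolding \<G>_def h_def by simp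
  have bM: "k \<in> borel_measurable M" if "k \<in> \<G>" for k
    using that by (intro measurable_borel) (simp add: \<G>_def borel_upper_gradient_def)
  have J_antimono: "J k' \<le> J k" if "\<And>x. k x \<le> k' x" for k k'
    unfolding J_def using that
    by (intro nn_integral_mono mult_left_mono) (auto simp: ennreal_inverse_one_plus_le_iff)
  have J_max: "J k \<le> J h" if "k \<in> \<G>" for k
  proof -
    have "J k \<le> (SUP n. j n)" unfolding j(2)[symmetric] using that by (rule SUP_upper)
    also have "\<dots> \<le> J h"
      unfolding g(2) by (intro SUP_least J_antimono) (auto simp: h_def intro: INF_lower)
    finally show ?thesis .
  qed
  have J_fin: "J k \<noteq> \<infinity>" for k
  proof -
    have "J k \<le> (\<integral>\<^sup>+x. ennreal (\<theta> x) \<partial>M)"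
      unfolding J_def
    proof (rule nn_integral_mono)
      fix x
      have "inverse (1 + k x) \<le> 1"
        using ennreal_inverse_one_plus_le_iff[of "k x" 0] by simp
      then show "ennreal (\<theta> x) * inverse (1 + k x) \<le> ennreal (\<theta> x)"
        using mult_left_mono[of _ 1 "ennreal (\<theta> x)"] by fastforce
    qed
    also have "\<dots> < \<infinity>"
      using \<theta>(2,3) by (simp add: nn_integral_eq_integral less_imp_le)
    finally show ?thesis by simp
  qed
  have "is_minimal_weak_upper_gradient M p (\<lambda>x. ereal (f x)) h"
    unfolding is_minimal_weak_upper_gradient_def
  proof (intro conjI allI impI)
    show "weak_upper_gradient M p (\<lambda>x. ereal (f x)) h" "Lp_loc M p h"
      using h by (auto simp: \<G>_def borel_upper_gradient_def)
    fix k assume "weak_upper_gradient M p (\<lambda>x. ereal (f x)) k \<and> Lp_loc M p k"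
    then obtain k' where k': "borel_upper_gradient f k'" "AE x in M. k' x = k x"
      using borel_upper_gradient_majorant by blast
    define m where "m x = (INF n::nat. (if n = 0 then h else k') x)" for x
    have m: "m \<in> \<G>"
      using borel_upper_gradient_INF[of f "\<lambda>n. if n = 0 then h else k'"] h k'(1)
      unfolding \<G>_def m_def by simp
    have mle: "m x \<le> h x" "m x \<le> k' x" for x
      unfolding m_def using INF_lower[of 0 UNIV "\<lambda>n::nat. (if n = 0 then h else k') x"]
        INF_lower[of 1 UNIV "\<lambda>n::nat. (if n = 0 then h else k') x"] by auto
    note [measurable] = bM[OF h] bM[OF m]
    have le: "ennreal (\<theta> x) * inverse (1 + h x) \<le> ennreal (\<theta> x) * inverse (1 + m x)" for x
      using mle(1) by (intro mult_left_mono) (auto simp: ennreal_inverse_one_plus_le_iff)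
    have "(\<integral>\<^sup>+x. ennreal (\<theta> x) * inverse (1 + m x) - ennreal (\<theta> x) * inverse (1 + h x) \<partial>M) = J m - J h"
      unfolding J_def by (rule nn_integral_diff) (use J_fin[of h] le in \<open>auto simp: J_def\<close>)
    also have "\<dots> = 0"
      using J_max[OF m] J_fin[of m] by (metis diff_eq_0_ennreal infinity_ennreal_def less_top)
    finally have "AE x in M. ennreal (\<theta> x) * inverse (1 + m x) - ennreal (\<theta> x) * inverse (1 + h x) = 0"
      by (subst (asm) nn_integral_0_iff_AE) auto
    then show "AE x in M. h x \<le> k x"
      using k'(2)
    proof eventually_elim
      case (elim x)
      have "ennreal (\<theta> x) * inverse (1 + m x) \<le> ennreal (\<theta> x) * inverse (1 + h x)"
        using elim(1) by (simp add: diff_eq_0_iff_ennreal)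
      then have "inverse (1 + m x) \<le> inverse (1 + h x)"
        using \<theta>(2)[of x] by (subst (asm) ennreal_mult_le_mult_iff) auto
      then have "h x \<le> m x" by (simp add: ennreal_inverse_one_plus_le_iff)
      with mle(2)[of x] elim(2) show ?case by simp
    qed
  qed
  then show ?thesis unfolding minimal_weak_upper_gradient_def by (metis someI_ex)
qed

text \<open>
  An upper gradient on the subspace \<open>B\<close> controls all pieces inside \<open>B\<close> of almost every curve in the
  whole space, also of curves that leave \<open>B\<close>.
\<close>
lemma weak_upper_gradient_restrict_along:
  assumes B [measurable]: "B \<in> sets M"
    and g: "weak_upper_gradient (restrict_space M B) p (\<lambda>x. ereal (f x)) g"
  obtains h where "h \<in> borel_measurable borel"
    "(\<integral>\<^sup>+x\<in>B. epowr (h x) p \<partial>M) = (\<integral>\<^sup>+x. epowr (g x) p \<partial>restrict_space M B)"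
    "almost_every_curve M p (\<lambda>\<gamma> l. \<forall>s t. 0 \<le> s \<longrightarrow> s \<le> t \<longrightarrow> t \<le> l \<longrightarrow> \<gamma> ` {s..t} \<subseteq> B \<longrightarrow>
       increment_le (along \<gamma> l f) (along \<gamma> l h) s t)"
proof -
  have "(\<lambda>x. g x * indicator B x) \<in> borel_measurable M"
    using g unfolding weak_upper_gradient_def
    by (subst (asm) borel_measurable_restrict_space_iff_ennreal) auto
  then obtain h where h: "h \<in> borel_measurable borel" "\<And>x. g x * indicator B x \<le> h x"
    "AE x in M. h x = g x * indicator B x"
    using borel_majorant by blast
  have gh: "g x \<le> h x" if "x \<in> B" for x using h(2)[of x] that by simp
  have "(\<integral>\<^sup>+x\<in>B. epowr (h x) p \<partial>M) = (\<integral>\<^sup>+x\<in>B. epowr (g x) p \<partial>M)"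
    by (rule nn_integral_cong_AE)
      (use h(3) in \<open>eventually_elim, simp split: split_indicator\<close>)
  also have "\<dots> = (\<integral>\<^sup>+x. epowr (g x) p \<partial>restrict_space M B)"
    by (subst nn_integral_restrict_space) auto
  finally have int: "(\<integral>\<^sup>+x\<in>B. epowr (h x) p \<partial>M) = (\<integral>\<^sup>+x. epowr (g x) p \<partial>restrict_space M B)" .
  have "almost_every_curve (restrict_space M B) p
      (\<lambda>\<gamma> l. ennreal \<bar>f (\<gamma> 0) - f (\<gamma> l)\<bar> \<le> curve_integral \<gamma> l g)"
    using g by (simp add: weak_upper_gradient_def oscillation_ereal)
  from almost_every_curve_subcurves[OF almost_every_curve_restrict[OF B this]]
  have "almost_every_curve M p (\<lambda>\<gamma> l. \<forall>s t. 0 \<le> s \<longrightarrow> s \<le> t \<longrightarrow> t \<le> l \<longrightarrow> \<gamma> ` {s..t} \<subseteq> B \<longrightarrow>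
      increment_le (along \<gamma> l f) (along \<gamma> l h) s t)"
  proof (rule almost_every_curve_mono, intro allI impI)
    fix \<gamma> l s t
    assume \<gamma>: "arclength_curve UNIV \<gamma> l"
      and sub: "\<forall>s t. 0 \<le> s \<longrightarrow> s < t \<longrightarrow> t \<le> l \<longrightarrow> (\<lambda>x. \<gamma> (s + x)) ` {0..t - s} \<subseteq> B \<longrightarrow>
        ennreal \<bar>f (\<gamma> (s + 0)) - f (\<gamma> (s + (t - s)))\<bar> \<le> curve_integral (\<lambda>x. \<gamma> (s + x)) (t - s) g"
      and st: "0 \<le> s" "s \<le> t" "t \<le> l" "\<gamma> ` {s..t} \<subseteq> B"
    show "increment_le (along \<gamma> l f) (along \<gamma> l h) s t"
    proof (cases "s = t")
      case False
      with st have "s < t" by simp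
      have inB: "\<gamma> (s + x) \<in> B" if "x \<in> {0..t - s}" for x
        using that st by (intro subsetD[OF st(4)] imageI) auto
      have "ennreal \<bar>f (\<gamma> s) - f (\<gamma> t)\<bar> \<le> curve_integral (\<lambda>x. \<gamma> (s + x)) (t - s) g"
        using sub[rule_format, OF st(1) \<open>s < t\<close> st(3)] inB by (simp add: image_subset_iff)
      also have "\<dots> \<le> curve_integral (\<lambda>x. \<gamma> (s + x)) (t - s) h"
        by (rule curve_integral_mono) (use inB gh in auto)
      also have "\<dots> = (\<integral>\<^sup>+x\<in>{s..t}. along \<gamma> l h x \<partial>lborel)"
        by (rule curve_integral_subcurve[OF \<gamma> h(1) st(1) \<open>s < t\<close> st(3)])
      finally show ?thesis using st by (simp add: increment_le_def along_eq abs_minus_commute)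
    qed (simp add: increment_le_def)
  qed
  with h(1) int that show ?thesis by blast
qed

section \<open>Construction of upper gradients\<close>

lemma newtonian_local_upper_gradient:
  assumes B [measurable]: "B \<in> sets M"
    and f: "(\<lambda>x. ereal (f x)) \<in> newtonian (restrict_space M B) p"
  obtains h where "h \<in> borel_measurable borel" "(\<integral>\<^sup>+x\<in>B. epowr (h x) p \<partial>M) < \<infinity>"
    "almost_every_curve M p (\<lambda>\<gamma> l. \<forall>s t. 0 \<le> s \<longrightarrow> s \<le> t \<longrightarrow> t \<le> l \<longrightarrow> \<gamma> ` {s..t} \<subseteq> B \<longrightarrow>
       increment_le (along \<gamma> l f) (along \<gamma> l h) s t)"
proof -
  have "(INF g\<in>{g. weak_upper_gradient (restrict_space M B) p (\<lambda>x. ereal (f x)) g}.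
      \<integral>\<^sup>+x. epowr (g x) p \<partial>restrict_space M B) < \<infinity>"
    (is "?I < \<infinity>")
  proof -
    have "?I \<le> newtonian_norm_pow (restrict_space M B) p (\<lambda>x. ereal (f x))"
      unfolding newtonian_norm_pow_def by (rule add_increasing) auto
    also have "\<dots> < \<infinity>" using f by (simp add: newtonian_def)
    finally show ?thesis .
  qed
  then obtain g where g: "weak_upper_gradient (restrict_space M B) p (\<lambda>x. ereal (f x)) g"
    "(\<integral>\<^sup>+x. epowr (g x) p \<partial>restrict_space M B) < \<infinity>"
    unfolding INF_less_iff by blast
  show ?thesis
    by (rule weak_upper_gradient_restrict_along[OF B g(1)]) (rule that, use g(2) in simp_all)
qed

text \<open>
  The balls \<open>cball c0 n\<close> are compact, so finitely many of the given balls \<open>B x\<close> with \<open>x \<in> T n\<close> cover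
  each of them. The upper gradient belonging to \<open>x \<in> T n\<close> is only used outside \<open>cball c0 (n - 1)\<close>:
  a point at distance \<open>d\<close> from \<open>c0\<close> is still covered, with \<open>n = \<lceil>d\<rceil>\<close>, but only finitely many
  terms are present near any point, so that the supremum is locally \<open>p\<close>-integrable.
\<close>
lemma locally_newtonian_upper_gradient:
  assumes f: "(\<lambda>x. ereal (f x)) \<in> newtonian_loc M p UNIV"
  shows "f \<in> borel_measurable M" and "\<exists>g. borel_upper_gradient f g"
proof -
  have "\<forall>x. \<exists>z r. x \<in> ball z r \<and> (\<lambda>x. ereal (f x)) \<in> newtonian (restrict_space M (ball z r)) p"
    using f by (simp add: newtonian_loc_def)
  then obtain z r where zr: "\<And>x. x \<in> ball (z x) (r x)"
    "\<And>x. (\<lambda>x. ereal (f x)) \<in> newtonian (restrict_space M (ball (z x) (r x))) p" by metis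
  define B where "B x = ball (z x) (r x)" for x
  have B: "x \<in> B x" "open (B x)" for x using zr(1) by (auto simp: B_def)
  have [measurable]: "B x \<in> sets M" "B x \<in> sets borel" for x by (auto simp: B_def)
  have newt: "(\<lambda>x. ereal (f x)) \<in> newtonian (restrict_space M (B x)) p" for x
    using zr(2) by (simp add: B_def)
  define adm where "adm x h \<longleftrightarrow> h \<in> borel_measurable borel \<and> (\<integral>\<^sup>+y\<in>B x. epowr (h y) p \<partial>M) < \<infinity> \<and>
      almost_every_curve M p (\<lambda>\<gamma> l. \<forall>s t. 0 \<le> s \<longrightarrow> s \<le> t \<longrightarrow> t \<le> l \<longrightarrow> \<gamma> ` {s..t} \<subseteq> B x \<longrightarrow>
        increment_le (along \<gamma> l f) (along \<gamma> l h) s t)" for x h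
  have "\<exists>h. adm x h" for x
    unfolding adm_def by (rule newtonian_local_upper_gradient[OF _ newt[of x]]) (simp, blast)
  then obtain h where adm: "\<And>x. adm x (h x)" by metis
  have h [measurable]: "\<And>x. h x \<in> borel_measurable borel"
    and fin: "\<And>x. (\<integral>\<^sup>+y\<in>B x. epowr (h x y) p \<partial>M) < \<infinity>"
    and ae: "\<And>x. almost_every_curve M p (\<lambda>\<gamma> l. \<forall>s t. 0 \<le> s \<longrightarrow> s \<le> t \<longrightarrow> t \<le> l \<longrightarrow>
      \<gamma> ` {s..t} \<subseteq> B x \<longrightarrow> increment_le (along \<gamma> l f) (along \<gamma> l (h x)) s t)"
    using adm unfolding adm_def by blast+
  note [measurable] = measurable_borel[OF h]
  \<comment> \<open>An arbitrary centre for exhausting the space by balls.\<close>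
  define c0 :: 'a where "c0 = undefined"
  have "\<exists>T. finite T \<and> cball c0 (real n) \<subseteq> (\<Union>x\<in>T. B x)" for n
    by (rule compactE_image[OF compact_cball, of UNIV B c0 "real n"]) (use B in blast)+
  then obtain T where T: "\<And>n. finite (T n)" "\<And>n. cball c0 (real n) \<subseteq> (\<Union>x\<in>T n. B x)" by metis
  have cover: "\<exists>n. \<exists>x\<in>T n. y \<in> B x \<and> real n - 1 < dist c0 y" for y
  proof -
    define n where "n = nat \<lceil>dist c0 y\<rceil>"
    have n: "dist c0 y \<le> real n" "real n - 1 < dist c0 y"
      unfolding n_def by (simp_all add: of_nat_nat) linarith+
    then have "y \<in> cball c0 (real n)" by simp
    then show ?thesis using T(2)[of n] n by blast
  qed
  have count: "countable (\<Union>n. T n)" using T(1) by (auto intro: countable_finite)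
  have meas: "(\<lambda>x. ereal (f x)) \<in> borel_measurable M"
  proof (rule measurable_piecewise_restrict)
    show "countable (B ` (\<Union>n. T n))" using count by simp
    show "space M \<subseteq> \<Union> (B ` (\<Union>n. T n))"
    proof
      fix y
      obtain n x where "x \<in> T n" "y \<in> B x" using cover[of y] by blast
      then show "y \<in> \<Union> (B ` (\<Union>n. T n))" by blast
    qed
    show "\<Omega> \<inter> space M \<in> sets M" if "\<Omega> \<in> B ` (\<Union>n. T n)" for \<Omega> using that by auto
    show "(\<lambda>x. ereal (f x)) \<in> borel_measurable (restrict_space M \<Omega>)" if "\<Omega> \<in> B ` (\<Union>n. T n)" for \<Omega>
      using that newt by (auto simp: newtonian_def)
  qed
  then show "f \<in> borel_measurable M" by simp
  define C where "C n = {y. real n - 1 < dist c0 y}" for n :: nat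
  have C: "open (C n)" for n unfolding C_def by (intro open_Collect_less continuous_intros)
  have [measurable]: "C n \<in> sets borel" for n using C by simp
  define g where "g y = (SUP n. SUP x\<in>T n. h x y * indicator (B x \<inter> C n) y)" for y
  have g [measurable]: "g \<in> borel_measurable borel"
    unfolding g_def by (intro borel_measurable_SUP) (use T(1) in \<open>auto intro: countable_finite\<close>)
  have gM [measurable]: "g \<in> borel_measurable M" by (rule measurable_borel[OF g])
  have g_ge: "h x y \<le> g y" if "x \<in> T n" "y \<in> B x \<inter> C n" for x y n
  proof -
    have "h x y * indicator (B x \<inter> C n) y \<le> g y"
      unfolding g_def by (rule SUP_upper2[OF UNIV_I], rule SUP_upper[OF that(1)])
    then show ?thesis using that(2) by simp
  qed
  have "(\<integral>\<^sup>+y\<in>ball x 1. epowr (g y) p \<partial>M) < \<infinity>" for x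
  proof -
    \<comment> \<open>The unit ball around \<open>x\<close> meets \<open>C n\<close> only for \<open>n < N\<close>.\<close>
    obtain N :: nat where N: "dist c0 x + 2 < real N" using reals_Archimedean2 by blast
    have "(\<integral>\<^sup>+y\<in>ball x 1. epowr (g y) p \<partial>M)
        \<le> (\<integral>\<^sup>+y. (\<Sum>n<N. \<Sum>x\<in>T n. epowr (h x y) p * indicator (B x) y) \<partial>M)"
    proof (rule nn_integral_mono)
      fix y
      let ?S = "\<Sum>n<N. \<Sum>x\<in>T n. epowr (h x y) p * indicator (B x) y"
      show "epowr (g y) p * indicator (ball x 1) y \<le> ?S"
      proof (cases "y \<in> ball x 1")
        case True
        have "epowr (g y) p \<le> ?S"
          unfolding g_def
        proof (intro epowr_SUP_le)
          fix n w assume w: "w \<in> T n"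
          show "epowr (h w y * indicator (B w \<inter> C n) y) p \<le> ?S"
          proof (cases "y \<in> B w \<inter> C n")
            case yes: True
            then have "n < N"
              using N True dist_triangle[of c0 y x] by (auto simp: C_def dist_commute)
            have "epowr (h w y * indicator (B w \<inter> C n) y) p \<le> (\<Sum>x\<in>T n. epowr (h x y) p * indicator (B x) y)"
              using member_le_sum[of w "T n" "\<lambda>x. epowr (h x y) p * indicator (B x) y"] w T(1) yes
              by simp
            also have "\<dots> \<le> ?S"
              using member_le_sum[of n "{..<N}" "\<lambda>n. \<Sum>x\<in>T n. epowr (h x y) p * indicator (B x) y"] \<open>n < N\<close>
              by simp
            finally show ?thesis .
          qed simp
        qed (use p in auto)
        then show ?thesis using True by simp
      qed simp
    qed
    also have "\<dots> = (\<Sum>n<N. \<Sum>x\<in>T n. (\<integral>\<^sup>+y\<in>B x. epowr (h x y) p \<partial>M))"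
      by (simp add: nn_integral_sum)
    also have "\<dots> < \<infinity>" using fin T(1) by (simp add: less_top)
    finally show ?thesis .
  qed
  then have Lp: "Lp_loc M p g" unfolding Lp_loc_def using gM by (auto intro!: exI[of _ 1])
  have "almost_every_curve M p (\<lambda>\<gamma> l. \<forall>x\<in>(\<Union>n. T n). \<forall>s t. 0 \<le> s \<longrightarrow> s \<le> t \<longrightarrow> t \<le> l \<longrightarrow>
      \<gamma> ` {s..t} \<subseteq> B x \<longrightarrow> increment_le (along \<gamma> l f) (along \<gamma> l (h x)) s t)"
    by (intro almost_every_curve_ball count ae)
  then have "almost_every_curve M p (upper_gradient_along f g)"
  proof (rule almost_every_curve_mono)
    fix \<gamma> l assume \<gamma>: "arclength_curve UNIV \<gamma> l"
      and *: "\<forall>x\<in>(\<Union>n. T n). \<forall>s t. 0 \<le> s \<longrightarrow> s \<le> t \<longrightarrow> t \<le> l \<longrightarrow>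
        \<gamma> ` {s..t} \<subseteq> B x \<longrightarrow> increment_le (along \<gamma> l f) (along \<gamma> l (h x)) s t"
    define \<gamma>' where "\<gamma>' x = \<gamma> (max 0 (min l x))" for x
    have cont: "continuous_on UNIV \<gamma>'" using continuous_along[OF \<gamma>] by (simp add: \<gamma>'_def[abs_def])
    show "upper_gradient_along f g \<gamma> l"
    proof (rule interval_upper_gradient_local)
      show "along \<gamma> l g \<in> borel_measurable borel" by (rule borel_measurable_along[OF \<gamma> g])
      fix \<tau> assume \<tau>: "0 \<le> \<tau>" "\<tau> \<le> l"
      obtain n x where x: "x \<in> T n" "\<gamma>' \<tau> \<in> B x \<inter> C n" using cover[of "\<gamma>' \<tau>"] by (auto simp: C_def)
      define W where "W = \<gamma>' -` (B x \<inter> C n)"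
      have "open W" unfolding W_def using B C by (intro open_vimage cont) auto
      moreover have "\<tau> \<in> W" using x by (simp add: W_def)
      moreover have "increment_le (along \<gamma> l f) (along \<gamma> l g) s t"
        if st: "0 \<le> s" "s \<le> t" "t \<le> l" "{s..t} \<subseteq> W" for s t
      proof -
        have in_BC: "\<gamma> y \<in> B x \<inter> C n" if "y \<in> {s..t}" for y
        proof -
          have "\<gamma>' y \<in> B x \<inter> C n" using st(4) that unfolding W_def by blast
          moreover have "\<gamma>' y = \<gamma> y" using st that by (simp add: \<gamma>'_def)
          ultimately show ?thesis by simp
        qed
        then have "increment_le (along \<gamma> l f) (along \<gamma> l (h x)) s t"
          using * x(1) st by blast
        then show ?thesis
        proof (rule increment_le_mono)
          fix y assume "s \<le> y" "y \<le> t"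
          then show "along \<gamma> l (h x) y \<le> along \<gamma> l g y"
            using g_ge[OF x(1) in_BC[of y]] st by (simp add: along_eq)
        qed
      qed
      ultimately show "\<exists>W. open W \<and> \<tau> \<in> W \<and> (\<forall>s t. 0 \<le> s \<longrightarrow> s \<le> t \<longrightarrow> t \<le> l \<longrightarrow>
          {s..t} \<subseteq> W \<longrightarrow> increment_le (along \<gamma> l f) (along \<gamma> l g) s t)" by blast
    qed
  qed
  then have "borel_upper_gradient f g"
    unfolding borel_upper_gradient_def using Lp g weak_upper_gradientI_along[OF gM] by blast
  then show "\<exists>g. borel_upper_gradient f g" by blast
qed

lemma lipschitz_upper_gradient:
  assumes L: "L-lipschitz_on UNIV (\<eta> :: 'a \<Rightarrow> real)"
  shows "borel_upper_gradient \<eta> (\<lambda>_. ennreal L)"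
proof -
  have L0: "0 \<le> L" using L by (rule lipschitz_on_nonneg)
  have "almost_every_curve M p (upper_gradient_along \<eta> (\<lambda>_. ennreal L))"
  proof (rule almost_every_curveI[where \<rho> = "\<lambda>_. 0"])
    fix \<gamma> l assume \<gamma>: "arclength_curve UNIV \<gamma> l" and bad: "\<not> upper_gradient_along \<eta> (\<lambda>_. ennreal L) \<gamma> l"
    have "upper_gradient_along \<eta> (\<lambda>_. ennreal L) \<gamma> l"
      unfolding interval_upper_gradient_def
    proof (intro allI impI)
      fix s t assume st: "0 \<le> s" "s \<le> t" "t \<le> l"
      have "\<bar>\<eta> (\<gamma> t) - \<eta> (\<gamma> s)\<bar> \<le> L * dist (\<gamma> t) (\<gamma> s)"
        using lipschitz_onD[OF L, of "\<gamma> t" "\<gamma> s"] by (simp add: dist_real_def)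
      also have "\<dots> \<le> L * (t - s)"
        using arclength_curve_dist_le[OF \<gamma> st] L0 by (intro mult_left_mono) (auto simp: dist_commute)
      finally have "ennreal \<bar>\<eta> (\<gamma> t) - \<eta> (\<gamma> s)\<bar> \<le> ennreal (L * (t - s))" by (rule ennreal_leI)
      also have "\<dots> = (\<integral>\<^sup>+x\<in>{s..t}. ennreal L \<partial>lborel)"
        using st L0 by (simp add: nn_integral_cmult_indicator ennreal_mult)
      finally show "increment_le (along \<gamma> l \<eta>) (along \<gamma> l (\<lambda>_. ennreal L)) s t"
        using st by (simp add: increment_le_def along_def)
    qed
    with bad show "curve_integral \<gamma> l (\<lambda>_. 0) = \<infinity>" by contradiction
  qed auto
  then show ?thesis
    unfolding borel_upper_gradient_def using Lp_loc_const weak_upper_gradient_iff_along by auto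
qed

lemma borel_upper_gradient_cmult:
  assumes g: "borel_upper_gradient f g" and c: "0 \<le> c"
  shows "borel_upper_gradient (\<lambda>x. c * f x) (\<lambda>x. ennreal c * g x)"
proof -
  have gb [measurable]: "g \<in> borel_measurable borel" and Lp: "Lp_loc M p g"
    using g by (auto simp: borel_upper_gradient_def)
  have [measurable]: "g \<in> borel_measurable M" by (rule measurable_borel[OF gb])
  have "almost_every_curve M p (upper_gradient_along f g)"
    using g weak_upper_gradient_iff_along[OF gb] by (simp add: borel_upper_gradient_def)
  then have "almost_every_curve M p (upper_gradient_along (\<lambda>x. c * f x) (\<lambda>x. ennreal c * g x))"
  proof (rule almost_every_curve_mono)
    fix \<gamma> l assume \<gamma>: "arclength_curve UNIV \<gamma> l" and *: "upper_gradient_along f g \<gamma> l"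
    have [measurable]: "along \<gamma> l g \<in> borel_measurable borel" by (rule borel_measurable_along[OF \<gamma> gb])
    show "upper_gradient_along (\<lambda>x. c * f x) (\<lambda>x. ennreal c * g x) \<gamma> l"
      unfolding interval_upper_gradient_def
    proof (intro allI impI)
      fix s t assume st: "0 \<le> s" "s \<le> t" "t \<le> l"
      have "\<bar>c * along \<gamma> l f t - c * along \<gamma> l f s\<bar> = c * \<bar>along \<gamma> l f t - along \<gamma> l f s\<bar>"
        using c by (simp add: abs_mult flip: right_diff_distrib)
      then have "ennreal \<bar>c * along \<gamma> l f t - c * along \<gamma> l f s\<bar>
          = ennreal c * ennreal \<bar>along \<gamma> l f t - along \<gamma> l f s\<bar>"
        using c by (simp add: ennreal_mult)
      also have "\<dots> \<le> ennreal c * (\<integral>\<^sup>+x\<in>{s..t}. along \<gamma> l g x \<partial>lborel)"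
        using interval_upper_gradientD[OF * st] by (intro mult_left_mono) (auto simp: increment_le_def)
      also have "\<dots> = (\<integral>\<^sup>+x\<in>{s..t}. (ennreal c * along \<gamma> l g x) \<partial>lborel)"
        by (subst nn_integral_cmult[symmetric]) (auto simp: mult.assoc)
      finally show "increment_le (along \<gamma> l (\<lambda>x. c * f x)) (along \<gamma> l (\<lambda>x. ennreal c * g x)) s t"
        by (simp add: increment_le_def along_def)
    qed
  qed
  moreover have "Lp_loc M p (\<lambda>x. ennreal c * g x)"
    unfolding Lp_loc_def
  proof (intro conjI ballI)
    fix x
    have "(\<integral>\<^sup>+y\<in>ball x 1. epowr (ennreal c * g y) p \<partial>M)
        = ennreal (c powr p) * (\<integral>\<^sup>+y\<in>ball x 1. epowr (g y) p \<partial>M)"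
      using c by (subst nn_integral_cmult[symmetric]) (auto simp: epowr_mult mult.assoc)
    also have "\<dots> \<le> ennreal (c powr p) * (\<integral>\<^sup>+y\<in>cball x 1. epowr (g y) p \<partial>M)"
      by (intro mult_left_mono nn_integral_mono) (auto split: split_indicator)
    also have "\<dots> < \<infinity>"
      using Lp_loc_compact[OF Lp compact_cball] by (simp add: ennreal_mult_less_top)
    finally show "\<exists>r>0. (\<integral>\<^sup>+y\<in>ball x r. epowr (ennreal c * g y) p \<partial>M) < \<infinity>"
      by (intro exI[of _ 1]) simp
  qed measurable
  ultimately show ?thesis
    unfolding borel_upper_gradient_def using weak_upper_gradient_iff_along by auto
qed

lemma weak_upper_gradient_restrict:
  assumes B [measurable]: "B \<in> sets M" and g: "weak_upper_gradient M p f g"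
  shows "weak_upper_gradient (restrict_space M B) p f g"
proof -
  have gM: "g \<in> borel_measurable M" using g by (simp add: weak_upper_gradient_def)
  obtain \<rho> where \<rho>: "\<rho> \<in> borel_measurable borel" "(\<integral>\<^sup>+x. epowr (\<rho> x) p \<partial>M) < \<infinity>"
    "\<And>\<gamma> l. arclength_curve UNIV \<gamma> l \<Longrightarrow>
      \<not> oscillation (f (\<gamma> 0)) (f (\<gamma> l)) \<le> curve_integral \<gamma> l g \<Longrightarrow> curve_integral \<gamma> l \<rho> = \<infinity>"
    using g almost_every_curveE unfolding weak_upper_gradient_def by blast
  have "(\<integral>\<^sup>+x. epowr (\<rho> x) p \<partial>restrict_space M B) \<le> (\<integral>\<^sup>+x. epowr (\<rho> x) p \<partial>M)"
    by (subst nn_integral_restrict_space)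
      (auto intro!: nn_integral_mono split: split_indicator)
  then have "(\<integral>\<^sup>+x. epowr (\<rho> x) p \<partial>restrict_space M B) < \<infinity>" using \<rho>(2) by simp
  moreover have "\<rho> \<in> borel_measurable (restrict_space M B)"
    by (intro measurable_restrict_space1 measurable_borel \<rho>)
  moreover have "arclength_curve UNIV \<gamma> l" if "arclength_curve B \<gamma> l" for \<gamma> l
    using that by (simp add: arclength_curve_def)
  ultimately show ?thesis
    unfolding weak_upper_gradient_def almost_every_curve_def
    using \<rho>(3) measurable_restrict_space1[OF gM] by (auto simp: space_restrict_space intro!: bexI[of _ \<rho>])
qed

section \<open>The energy estimate\<close>

text \<open>
  Where \<open>g\<close> exceeds \<open>f\<close> the maximum behaves like \<open>g\<close>. Along the curve both functions are continuous,
  so this happens on an open set of parameters, and locality on open sets applies. The sum \<open>a + b\<close>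
  is an upper gradient for trivial reasons and serves on the complement.
\<close>
lemma upper_gradient_max_along:
  assumes \<gamma>: "arclength_curve UNIV \<gamma> l"
    and a: "a \<in> borel_measurable borel" "upper_gradient_along f a \<gamma> l"
      "(\<integral>\<^sup>+x\<in>{0..l}. along \<gamma> l a x \<partial>lborel) < \<infinity>"
    and b: "b \<in> borel_measurable borel" "upper_gradient_along g b \<gamma> l"
      "(\<integral>\<^sup>+x\<in>{0..l}. along \<gamma> l b x \<partial>lborel) < \<infinity>"
  shows "upper_gradient_along (\<lambda>x. max (f x) (g x)) (\<lambda>x. if f x < g x then b x else a x + b x) \<gamma> l"
proof -
  have am [measurable]: "along \<gamma> l a \<in> borel_measurable borel"
    and bm [measurable]: "along \<gamma> l b \<in> borel_measurable borel"
    by (rule borel_measurable_along[OF \<gamma> a(1)], rule borel_measurable_along[OF \<gamma> b(1)])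
  let ?F = "along \<gamma> l f" and ?G = "along \<gamma> l g"
  have cont_along: "continuous_on UNIV (along \<gamma> l h)" if "continuous_on {0..l} (along \<gamma> l h)" for h :: "'a \<Rightarrow> real"
  proof -
    have "continuous_on UNIV (\<lambda>x. along \<gamma> l h (max 0 (min l x)))"
      by (rule continuous_on_compose2[OF that])
        (use \<gamma> in \<open>auto simp: arclength_curve_def intro!: continuous_intros\<close>)
    moreover have "along \<gamma> l h (max 0 (min l x)) = along \<gamma> l h x" for x
      using \<gamma> by (auto simp: along_def arclength_curve_def max_def min_def)
    ultimately show ?thesis by simp
  qed
  have cont: "continuous_on UNIV ?F" "continuous_on UNIV ?G"
    by (rule cont_along, rule interval_upper_gradient_continuous_on[OF am a(3) a(2)],
        rule cont_along, rule interval_upper_gradient_continuous_on[OF bm b(3) b(2)])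
  define U where "U = {x. ?F x < ?G x}"
  have U: "open U" unfolding U_def by (rule open_Collect_less[OF cont])
  have "interval_upper_gradient l (\<lambda>x. max (?F x) (?G x))
      (\<lambda>x. if x \<in> U then along \<gamma> l b x else along \<gamma> l a x + along \<gamma> l b x)"
  proof (rule interval_upper_gradient_replace_open[OF _ _ _ b(3) _ U])
    show "(\<integral>\<^sup>+x\<in>{0..l}. (along \<gamma> l a x + along \<gamma> l b x) \<partial>lborel) < \<infinity>"
      using a(3) b(3) by (simp add: distrib_right nn_integral_add)
    show "interval_upper_gradient l (\<lambda>x. max (?F x) (?G x)) (\<lambda>x. along \<gamma> l a x + along \<gamma> l b x)"
      by (rule interval_upper_gradient_add[OF am bm a(2) b(2)]) (auto simp: max_def)
    fix s t assume st: "0 \<le> s" "s \<le> t" "t \<le> l" "{s..t} \<subseteq> U"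
    then have "s \<in> U" "t \<in> U" by auto
    then have "max (?F s) (?G s) = ?G s" "max (?F t) (?G t) = ?G t" by (auto simp: U_def)
    then show "increment_le (\<lambda>x. max (?F x) (?G x)) (along \<gamma> l b) s t"
      using interval_upper_gradientD[OF b(2) st(1-3)] by (simp add: increment_le_def)
  qed measurable
  then show ?thesis by (simp add: U_def along_def[abs_def] if_distrib cong: if_cong)
qed

text \<open>
  The positive part of \<open>g - f\<close> vanishes on the open complement of \<open>S\<close>, so its upper gradient may be
  cut off there; this is what makes the test function of the energy estimate globally integrable.
\<close>
lemma upper_gradient_pos_part_along:
  assumes \<gamma>: "arclength_curve UNIV \<gamma> l" and S: "closed S"
    and a: "a \<in> borel_measurable borel" "upper_gradient_along f a \<gamma> l"
      "(\<integral>\<^sup>+x\<in>{0..l}. along \<gamma> l a x \<partial>lborel) < \<infinity>"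
    and b: "b \<in> borel_measurable borel" "upper_gradient_along g b \<gamma> l"
      "(\<integral>\<^sup>+x\<in>{0..l}. along \<gamma> l b x \<partial>lborel) < \<infinity>"
    and zero: "\<And>x. x \<notin> S \<Longrightarrow> g x \<le> f x"
  shows "upper_gradient_along (\<lambda>x. max (g x - f x) 0) (\<lambda>x. (a x + b x) * indicator S x) \<gamma> l"
proof -
  have am [measurable]: "along \<gamma> l a \<in> borel_measurable borel"
    and bm [measurable]: "along \<gamma> l b \<in> borel_measurable borel"
    by (rule borel_measurable_along[OF \<gamma> a(1)], rule borel_measurable_along[OF \<gamma> b(1)])
  let ?F = "along \<gamma> l f" and ?G = "along \<gamma> l g"
  define U where "U = (\<lambda>x. \<gamma> (max 0 (min l x))) -` (- S)"
  have U: "open U" unfolding U_def by (intro open_vimage continuous_along[OF \<gamma>]) (use S in auto)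
  have "interval_upper_gradient l (\<lambda>x. max (?G x - ?F x) 0)
      (\<lambda>x. if x \<in> U then 0 else along \<gamma> l a x + along \<gamma> l b x)"
  proof (rule interval_upper_gradient_replace_open[OF _ _ _ _ _ U])
    show "(\<integral>\<^sup>+x\<in>{0..l}. (along \<gamma> l a x + along \<gamma> l b x) \<partial>lborel) < \<infinity>"
      using a(3) b(3) by (simp add: distrib_right nn_integral_add)
    show "interval_upper_gradient l (\<lambda>x. max (?G x - ?F x) 0) (\<lambda>x. along \<gamma> l a x + along \<gamma> l b x)"
      by (rule interval_upper_gradient_add[OF am bm a(2) b(2)]) (auto simp: max_def)
    fix s t assume st: "0 \<le> s" "s \<le> t" "t \<le> l" "{s..t} \<subseteq> U"
    then have "s \<in> U" "t \<in> U" by auto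
    then have "?G s \<le> ?F s" "?G t \<le> ?F t" using zero by (auto simp: U_def along_def)
    then show "increment_le (\<lambda>x. max (?G x - ?F x) 0) (\<lambda>_. 0) s t"
      by (simp add: increment_le_def)
  qed simp_all
  moreover have "(\<lambda>x. if x \<in> U then 0 else along \<gamma> l a x + along \<gamma> l b x)
      = along \<gamma> l (\<lambda>x. (a x + b x) * indicator S x)"
    by (auto simp: U_def along_def fun_eq_iff)
  ultimately show ?thesis by (simp add: along_def[abs_def])
qed

lemma restrict_space_UNIV_eq: "restrict_space M UNIV = M"
  by (intro measure_eqI) (auto simp: sets_restrict_space emeasure_restrict_space)

lemma minimal_weak_upper_gradient_le:
  assumes "weak_upper_gradient M p (\<lambda>x. ereal (f x)) g" "Lp_loc M p g"
  shows "AE x in M. minimal_weak_upper_gradient M p (\<lambda>x. ereal (f x)) x \<le> g x"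
  using minimal_weak_upper_gradient[OF assms] assms
  unfolding is_minimal_weak_upper_gradient_def by blast

text \<open>
  The test function \<open>\<phi> = max (c \<eta> - f) 0\<close> turns \<open>f\<close> into \<open>max f (c \<eta>)\<close>, whose minimal upper gradient
  on \<open>{\<phi> \<noteq> 0}\<close> is at most \<open>c\<close> times that of \<open>\<eta>\<close>. Since the upper bound \<open>c\<close> of \<open>f\<close> is strict, this set
  contains \<open>K\<close>. The gradient of \<open>f\<close> does not enter the right-hand side, so nothing has
  to be absorbed into the left-hand side.
\<close>
lemma energy_estimate:
  fixes f \<eta> :: "'a \<Rightarrow> real"
  assumes qsm: "quasisuperminimizer M p Q UNIV (\<lambda>x. ereal (f x))"
    and f: "\<And>x. 0 \<le> f x" "\<And>x. f x < c" and c: "0 \<le> c"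
    and L: "L-lipschitz_on UNIV \<eta>" and S: "compact (closure {x. \<eta> x \<noteq> 0})"
    and K: "\<And>x. x \<in> K \<Longrightarrow> 1 \<le> \<eta> x"
  shows "(\<integral>\<^sup>+x\<in>K. epowr (minimal_weak_upper_gradient M p (\<lambda>x. ereal (f x)) x) p \<partial>M)
    \<le> ennreal Q * (ennreal (c powr p) *
        (\<integral>\<^sup>+x. epowr (minimal_weak_upper_gradient M p (\<lambda>x. ereal (\<eta> x)) x) p \<partial>M))"
proof -
  define S where "S = closure {x. \<eta> x \<noteq> 0}"
  have S: "compact S" "closed S" using assms by (auto simp: S_def)
  have \<eta>0: "\<eta> x = 0" if "x \<notin> S" for x using that closure_subset[of "{x. \<eta> x \<noteq> 0}"] by (auto simp: S_def)
  have "(\<lambda>x. ereal (f x)) \<in> newtonian_loc M p UNIV" using qsm by (simp add: quasisuperminimizer_def)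
  then have fM [measurable]: "f \<in> borel_measurable M" and "\<exists>a. borel_upper_gradient f a"
    using locally_newtonian_upper_gradient by auto
  then obtain a where a: "borel_upper_gradient f a" by blast
  have cont: "continuous_on UNIV \<eta>" using L by (rule lipschitz_on_continuous_on)
  have [measurable]: "\<eta> \<in> borel_measurable M"
    by (intro measurable_borel borel_measurable_continuous_onI cont)
  define G where "G = minimal_weak_upper_gradient M p (\<lambda>x. ereal (\<eta> x))"
  have \<eta>L: "borel_upper_gradient \<eta> (\<lambda>_. ennreal L)" by (rule lipschitz_upper_gradient[OF L])
  have "is_minimal_weak_upper_gradient M p (\<lambda>x. ereal (\<eta> x)) G"
    unfolding G_def using \<eta>L by (intro minimal_weak_upper_gradient) (auto simp: borel_upper_gradient_def)
  then obtain e where e: "borel_upper_gradient \<eta> e" "AE x in M. e x = G x"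
    using borel_upper_gradient_majorant[of \<eta> G] by (auto simp: is_minimal_weak_upper_gradient_def)
  define b where "b x = ennreal c * e x" for x
  have b: "borel_upper_gradient (\<lambda>x. c * \<eta> x) b"
    unfolding b_def by (rule borel_upper_gradient_cmult[OF e(1) c])
  have ab [measurable]: "a \<in> borel_measurable borel" "b \<in> borel_measurable borel"
    using a b by (auto simp: borel_upper_gradient_def)
  note [measurable] = measurable_borel[OF ab(1)] measurable_borel[OF ab(2)]
  have curves: "almost_every_curve M p (\<lambda>\<gamma> l.
      (upper_gradient_along f a \<gamma> l \<and> (\<integral>\<^sup>+x\<in>{0..l}. along \<gamma> l a x \<partial>lborel) < \<infinity>) \<and>
      (upper_gradient_along (\<lambda>x. c * \<eta> x) b \<gamma> l \<and> (\<integral>\<^sup>+x\<in>{0..l}. along \<gamma> l b x \<partial>lborel) < \<infinity>))"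
    by (intro almost_every_curve_conj borel_upper_gradient_along a b)
  have Lp_ab: "Lp_loc M p (\<lambda>x. a x + b x)"
    using a b by (intro Lp_loc_add) (auto simp: borel_upper_gradient_def)
  define \<phi> where "\<phi> x = max (c * \<eta> x - f x) 0" for x
  have \<phi>S: "\<phi> x = 0" if "x \<notin> S" for x using \<eta>0[OF that] f(1)[of x] by (simp add: \<phi>_def)
  have \<phi>_newt: "(\<lambda>x. ereal (\<phi> x)) \<in> newtonian M p"
  proof -
    have "compact (\<eta> ` S)" by (intro compact_continuous_image S continuous_on_subset[OF cont]) auto
    then have "bounded (\<eta> ` S)" by (rule compact_imp_bounded)
    then obtain D where "\<forall>y\<in>\<eta> ` S. \<bar>y\<bar> \<le> D" unfolding bounded_real by blast
    then have D: "\<bar>\<eta> x\<bar> \<le> D" if "x \<in> S" for x using that by simp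
    have \<phi>D: "\<phi> x \<le> c * D" "0 \<le> c * D" if "x \<in> S" for x
    proof -
      have "c * \<eta> x \<le> c * D" using D[OF that] c by (intro mult_left_mono) auto
      moreover show "0 \<le> c * D" using D[OF that] c by (intro mult_nonneg_nonneg) auto
      ultimately show "\<phi> x \<le> c * D" using f(1)[of x] by (simp add: \<phi>_def)
    qed
    have "(\<integral>\<^sup>+x. epowr (e2ennreal \<bar>ereal (\<phi> x)\<bar>) p \<partial>M) \<le> (\<integral>\<^sup>+x\<in>S. epowr (ennreal (c * D)) p \<partial>M)"
    proof (rule nn_integral_mono)
      fix x
      show "epowr (e2ennreal \<bar>ereal (\<phi> x)\<bar>) p \<le> epowr (ennreal (c * D)) p * indicator S x"
      proof (cases "x \<in> S")
        case True
        moreover have "\<bar>\<phi> x\<bar> = \<phi> x" by (simp add: \<phi>_def)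
        ultimately show ?thesis using \<phi>D[OF True] p by (auto intro!: epowr_mono ennreal_leI)
      qed (simp add: \<phi>S)
    qed
    also have "\<dots> < \<infinity>" by (rule Lp_loc_compact[OF Lp_loc_const S(1)])
    finally have 1: "(\<integral>\<^sup>+x. epowr (e2ennreal \<bar>ereal (\<phi> x)\<bar>) p \<partial>M) < \<infinity>" .
    have [measurable]: "S \<in> sets M" using S by (auto intro: open_sets)
    have "weak_upper_gradient M p (\<lambda>x. ereal (\<phi> x)) (\<lambda>x. (a x + b x) * indicator S x)"
    proof (rule weak_upper_gradientI_along)
      show "almost_every_curve M p (upper_gradient_along \<phi> (\<lambda>x. (a x + b x) * indicator S x))"
        using curves
      proof (rule almost_every_curve_mono)
        fix \<gamma> l assume \<gamma>: "arclength_curve UNIV \<gamma> l"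
          and *: "(upper_gradient_along f a \<gamma> l \<and> (\<integral>\<^sup>+x\<in>{0..l}. along \<gamma> l a x \<partial>lborel) < \<infinity>) \<and>
            (upper_gradient_along (\<lambda>x. c * \<eta> x) b \<gamma> l \<and> (\<integral>\<^sup>+x\<in>{0..l}. along \<gamma> l b x \<partial>lborel) < \<infinity>)"
        show "upper_gradient_along \<phi> (\<lambda>x. (a x + b x) * indicator S x) \<gamma> l"
          unfolding \<phi>_def[abs_def]
          by (rule upper_gradient_pos_part_along[OF \<gamma> S(2) ab(1) _ _ ab(2)])
            (use * \<eta>0 f(1) in auto)
      qed
    qed measurable
    moreover have "(\<integral>\<^sup>+x. epowr ((a x + b x) * indicator S x) p \<partial>M) < \<infinity>"
    proof -
      have "(\<integral>\<^sup>+x. epowr ((a x + b x) * indicator S x) p \<partial>M) = (\<integral>\<^sup>+x\<in>S. epowr (a x + b x) p \<partial>M)"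
        by (intro nn_integral_cong) (simp split: split_indicator)
      then show ?thesis using Lp_loc_compact[OF Lp_ab S(1)] by simp
    qed
    ultimately have 2: "(INF g\<in>{g. weak_upper_gradient M p (\<lambda>x. ereal (\<phi> x)) g}. \<integral>\<^sup>+x. epowr (g x) p \<partial>M) < \<infinity>"
      unfolding INF_less_iff by - (rule bexI[of _ "\<lambda>x. (a x + b x) * indicator S x"], simp_all)
    have "(\<lambda>x. ereal (\<phi> x)) \<in> borel_measurable M" unfolding \<phi>_def by measurable
    then show ?thesis using 1 2 by (simp add: newtonian_def newtonian_norm_pow_def)
  qed
  define V where "V = {x. \<phi> x \<noteq> 0}"
  have V: "V = {x. f x < c * \<eta> x}" by (auto simp: V_def \<phi>_def max_def)
  define h where "h x = (if f x < c * \<eta> x then b x else a x + b x)" for x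
  have hM [measurable]: "h \<in> borel_measurable M" unfolding h_def by measurable
  have "weak_upper_gradient M p (\<lambda>x. ereal (max (f x) (c * \<eta> x))) h"
  proof (rule weak_upper_gradientI_along[OF hM])
    show "almost_every_curve M p (upper_gradient_along (\<lambda>x. max (f x) (c * \<eta> x)) h)"
      using curves
    proof (rule almost_every_curve_mono)
      fix \<gamma> l assume \<gamma>: "arclength_curve UNIV \<gamma> l"
        and *: "(upper_gradient_along f a \<gamma> l \<and> (\<integral>\<^sup>+x\<in>{0..l}. along \<gamma> l a x \<partial>lborel) < \<infinity>) \<and>
            (upper_gradient_along (\<lambda>x. c * \<eta> x) b \<gamma> l \<and> (\<integral>\<^sup>+x\<in>{0..l}. along \<gamma> l b x \<partial>lborel) < \<infinity>)"
      show "upper_gradient_along (\<lambda>x. max (f x) (c * \<eta> x)) h \<gamma> l"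
        unfolding h_def[abs_def]
        by (rule upper_gradient_max_along[OF \<gamma> ab(1) _ _ ab(2)]) (use * in auto)
    qed
  qed
  moreover have "Lp_loc M p h"
    by (rule Lp_loc_mono[OF Lp_ab hM]) (auto simp: h_def add_increasing)
  ultimately have le_h: "AE x in M. minimal_weak_upper_gradient M p (\<lambda>x. ereal (max (f x) (c * \<eta> x))) x \<le> h x"
    by (rule minimal_weak_upper_gradient_le)
  have sum_eq: "(\<lambda>x. ereal (f x) + ereal (\<phi> x)) = (\<lambda>x. ereal (max (f x) (c * \<eta> x)))"
    by (auto simp: \<phi>_def max_def)
  have \<phi>_zero: "(\<lambda>x. ereal (\<phi> x)) \<in> newtonian_zero M p UNIV"
    unfolding newtonian_zero_def using \<phi>_newt by auto
  have "0 \<le> \<phi> x" for x by (simp add: \<phi>_def)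
  then have \<phi>_nonneg: "\<forall>x\<in>UNIV. 0 \<le> ereal (\<phi> x)" by simp
  have V_eq: "{x \<in> UNIV. ereal (\<phi> x) \<noteq> 0} = V" by (simp add: V_def)
  have main: "(\<integral>\<^sup>+x\<in>V. epowr (minimal_weak_upper_gradient M p (\<lambda>x. ereal (f x)) x) p \<partial>M)
      \<le> ennreal Q * (\<integral>\<^sup>+x\<in>V. epowr (minimal_weak_upper_gradient M p (\<lambda>x. ereal (max (f x) (c * \<eta> x))) x) p \<partial>M)"
    using qsm[unfolded quasisuperminimizer_def restrict_space_UNIV_eq, THEN conjunct2,
        THEN bspec, OF \<phi>_zero, THEN mp, OF \<phi>_nonneg]
    unfolding V_eq sum_eq .
  have "K \<subseteq> V"
  proof
    fix x assume "x \<in> K"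
    then have "c * 1 \<le> c * \<eta> x" using K c by (intro mult_left_mono) auto
    then show "x \<in> V" using f(2)[of x] by (simp add: V)
  qed
  then have "(\<integral>\<^sup>+x\<in>K. epowr (minimal_weak_upper_gradient M p (\<lambda>x. ereal (f x)) x) p \<partial>M)
      \<le> (\<integral>\<^sup>+x\<in>V. epowr (minimal_weak_upper_gradient M p (\<lambda>x. ereal (f x)) x) p \<partial>M)"
    by (intro nn_integral_mono) (auto split: split_indicator)
  also note main
  also have "(\<integral>\<^sup>+x\<in>V. epowr (minimal_weak_upper_gradient M p (\<lambda>x. ereal (max (f x) (c * \<eta> x))) x) p \<partial>M)
      \<le> (\<integral>\<^sup>+x. ennreal (c powr p) * epowr (G x) p \<partial>M)"
  proof (rule nn_integral_mono_AE)
    show "AE x in M. epowr (minimal_weak_upper_gradient M p (\<lambda>x. ereal (max (f x) (c * \<eta> x))) x) p * indicator V x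
        \<le> ennreal (c powr p) * epowr (G x) p"
      using le_h e(2)
    proof eventually_elim
      case (elim x)
      show ?case
      proof (cases "x \<in> V")
        case True
        then have "minimal_weak_upper_gradient M p (\<lambda>x. ereal (max (f x) (c * \<eta> x))) x \<le> ennreal c * G x"
          using elim by (simp add: h_def V b_def)
        from epowr_mono[OF _ this, of p] True p c show ?thesis by (simp add: epowr_mult)
      qed simp
    qed
  qed
  also have "\<dots> = ennreal (c powr p) * (\<integral>\<^sup>+x. epowr (G x) p \<partial>M)"
  proof (rule nn_integral_cmult)
    have "G \<in> borel_measurable M"
      using \<open>is_minimal_weak_upper_gradient M p (\<lambda>x. ereal (\<eta> x)) G\<close>
      by (simp add: is_minimal_weak_upper_gradient_def Lp_loc_def)
    then show "(\<lambda>x. epowr (G x) p) \<in> borel_measurable M" by measurable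
  qed
  finally show ?thesis by (simp add: G_def mult_left_mono)
qed

section \<open>Vanishing gradients and constancy\<close>

text \<open>
  A bounded space is compact, so the constant 1 is an admissible function with vanishing gradient.
\<close>
lemma p_capacity_bounded:
  assumes "bounded (UNIV :: 'a set)"
  shows "p_capacity M p K = 0"
proof -
  have lip: "0-lipschitz_on UNIV (\<lambda>_::'a. 1::real)" by (simp add: lipschitz_on_def)
  have comp: "compact (UNIV :: 'a set)" using proper assms by (simp add: proper_metric_def)
  have "borel_upper_gradient (\<lambda>_. 1) (\<lambda>_. ennreal 0)" by (rule lipschitz_upper_gradient[OF lip])
  then have "AE x in M. minimal_weak_upper_gradient M p (\<lambda>_. ereal 1) x \<le> ennreal 0"
    by (intro minimal_weak_upper_gradient_le) (auto simp: borel_upper_gradient_def)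
  then have "AE x in M. epowr (minimal_weak_upper_gradient M p (\<lambda>_. ereal 1) x) p = 0"
    by eventually_elim simp
  then have "(\<integral>\<^sup>+x. epowr (minimal_weak_upper_gradient M p (\<lambda>_. ereal 1) x) p \<partial>M) = (\<integral>\<^sup>+x. 0 \<partial>M)"
    by (rule nn_integral_cong_AE)
  then have 0: "(\<integral>\<^sup>+x. epowr (minimal_weak_upper_gradient M p (\<lambda>_. ereal 1) x) p \<partial>M) = 0" by simp
  have "p_capacity M p K \<le> (\<integral>\<^sup>+x. epowr (minimal_weak_upper_gradient M p (\<lambda>_. ereal 1) x) p \<partial>M)"
    unfolding p_capacity_def
    by (rule INF_lower2[of "\<lambda>_. 1"]) (use lip comp in auto)
  then show ?thesis unfolding 0 by simp
qed

text \<open>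
  Taking the infimum over \<open>\<eta>\<close> in the energy estimate bounds the energy of \<open>f\<close> on each compact set by
  a multiple of its capacity; the space is a countable union of closed balls, which are compact.
\<close>
lemma minimal_weak_upper_gradient_eq_0:
  fixes f :: "'a \<Rightarrow> real"
  assumes qsm: "quasisuperminimizer M p Q UNIV (\<lambda>x. ereal (f x))" and Q: "1 \<le> Q"
    and f: "\<And>x. 0 \<le> f x" "\<And>x. f x < c" and c: "0 < c"
    and cap: "\<And>K. compact K \<Longrightarrow> p_capacity M p K = 0"
  shows "AE x in M. minimal_weak_upper_gradient M p (\<lambda>x. ereal (f x)) x = 0"
proof -
  define G where "G = minimal_weak_upper_gradient M p (\<lambda>x. ereal (f x))"
  have "(\<lambda>x. ereal (f x)) \<in> newtonian_loc M p UNIV" using qsm by (simp add: quasisuperminimizer_def)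
  then obtain a where "borel_upper_gradient f a" using locally_newtonian_upper_gradient by blast
  then have "is_minimal_weak_upper_gradient M p (\<lambda>x. ereal (f x)) G"
    unfolding G_def by (intro minimal_weak_upper_gradient) (auto simp: borel_upper_gradient_def)
  then have GM [measurable]: "G \<in> borel_measurable M"
    by (simp add: is_minimal_weak_upper_gradient_def Lp_loc_def)
  have zero: "(\<integral>\<^sup>+x\<in>K. epowr (G x) p \<partial>M) = 0" if K: "compact K" for K
  proof -
    define D where "D = Q * c powr p"
    have D: "0 < D" using Q c by (simp add: D_def)
    have "(\<integral>\<^sup>+x\<in>K. epowr (G x) p \<partial>M) / ennreal D \<le> p_capacity M p K"
      unfolding p_capacity_def
    proof (rule INF_greatest, clarsimp)
      fix \<eta> :: "'a \<Rightarrow> real" and L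
      assume "\<forall>x\<in>K. 1 \<le> \<eta> x" "L-lipschitz_on UNIV \<eta>" "compact (closure {x. \<eta> x \<noteq> 0})"
      then have "(\<integral>\<^sup>+x\<in>K. epowr (G x) p \<partial>M) \<le> ennreal Q * (ennreal (c powr p) *
          (\<integral>\<^sup>+x. epowr (minimal_weak_upper_gradient M p (\<lambda>x. ereal (\<eta> x)) x) p \<partial>M))"
        unfolding G_def by (intro energy_estimate[OF qsm f less_imp_le[OF c]]) auto
      also have "\<dots> = ennreal D * (\<integral>\<^sup>+x. epowr (minimal_weak_upper_gradient M p (\<lambda>x. ereal (\<eta> x)) x) p \<partial>M)"
        using Q by (simp add: D_def ennreal_mult mult.assoc)
      finally show "(\<integral>\<^sup>+x\<in>K. epowr (G x) p \<partial>M) / ennreal D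
          \<le> (\<integral>\<^sup>+x. epowr (minimal_weak_upper_gradient M p (\<lambda>x. ereal (\<eta> x)) x) p \<partial>M)"
        using D by (intro divide_le_posI_ennreal) auto
    qed
    then show ?thesis using cap[OF K] by simp
  qed
  have "AE x in M. x \<in> cball undefined (real n) \<longrightarrow> G x = 0" for n
  proof -
    have "AE x in M. epowr (G x) p * indicator (cball undefined (real n)) x = 0"
      using zero[OF compact_cball] by (subst (asm) nn_integral_0_iff_AE) auto
    then show ?thesis by eventually_elim (auto split: split_indicator_asm)
  qed
  then have "AE x in M. \<forall>n. x \<in> cball undefined (real n) \<longrightarrow> G x = 0"
    unfolding AE_all_countable by blast
  then show ?thesis
    unfolding G_def[symmetric]
  proof eventually_elim
    case (elim x)
    obtain n :: nat where "dist undefined x < real n" using reals_Archimedean2 by blast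
    then have "x \<in> cball undefined (real n)" by simp
    then show ?case using elim by blast
  qed
qed

text \<open>
  With a vanishing gradient the right-hand side of the Poincare inequality is zero, so \<open>f\<close> agrees
  with its mean value.
\<close>
lemma AE_eq_const_on_ball:
  fixes f :: "'a \<Rightarrow> real"
  assumes poincare: "poincare_within M p (ball x r)" and r: "0 < r"
    and pos: "0 < emeasure M (ball x r)"
    and fM [measurable]: "f \<in> borel_measurable M" and f: "\<And>x. 0 \<le> f x" "\<And>x. f x \<le> k"
    and G: "weak_upper_gradient M p (\<lambda>x. ereal (f x)) G" "AE x in M. G x = 0"
  shows "\<exists>m. AE y in M. y \<in> ball x r \<longrightarrow> f y = m"
proof -
  define u where "u = (\<lambda>x. ereal (f x))"
  define m where "m = ball_mean M (ball x r) u"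
  obtain C \<Lambda> where C: "C > 0" "\<Lambda> \<ge> 1" and P: "\<And>z s u g.
        0 < s \<and> ball z s \<subseteq> ball x r \<and>
        u \<in> borel_measurable (restrict_space M (ball z (\<Lambda> * s))) \<and>
        (\<integral>\<^sup>+ x\<in>ball z (\<Lambda> * s). e2ennreal \<bar>u x\<bar> \<partial>M) < \<infinity> \<and>
        weak_upper_gradient (restrict_space M (ball z (\<Lambda> * s))) p u g \<longrightarrow>
        (\<integral>\<^sup>+ x\<in>ball z s. e2ennreal \<bar>u x - ereal (ball_mean M (ball z s) u)\<bar> \<partial>M)
            / emeasure M (ball z s)
          \<le> ennreal (C * s) *
            epowr ((\<integral>\<^sup>+ x\<in>ball z (\<Lambda> * s). epowr (g x) p \<partial>M) / emeasure M (ball z (\<Lambda> * s))) (1 / p)"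
    using poincare unfolding poincare_within_def by blast
  let ?B = "ball x (\<Lambda> * r)"
  have \<Lambda>r: "0 < \<Lambda> * r" using C(2) r by (intro mult_pos_pos) auto
  have uM [measurable]: "u \<in> borel_measurable M" unfolding u_def by measurable
  have "(\<integral>\<^sup>+y\<in>?B. e2ennreal \<bar>u y\<bar> \<partial>M) \<le> (\<integral>\<^sup>+y\<in>?B. ennreal k \<partial>M)"
    using f by (intro nn_integral_mono) (auto simp: u_def intro!: ennreal_leI split: split_indicator)
  also have "\<dots> < \<infinity>"
    using finite_balls[OF \<Lambda>r, of x] by (simp add: nn_integral_cmult_indicator ennreal_mult_less_top)
  finally have int: "(\<integral>\<^sup>+y\<in>?B. e2ennreal \<bar>u y\<bar> \<partial>M) < \<infinity>" .
  have "(\<integral>\<^sup>+y\<in>?B. epowr (G y) p \<partial>M) = (\<integral>\<^sup>+y. 0 \<partial>M)"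
    by (rule nn_integral_cong_AE) (use G(2) in \<open>eventually_elim, simp\<close>)
  then have G0: "(\<integral>\<^sup>+y\<in>?B. epowr (G y) p \<partial>M) = 0" by simp
  have "(\<integral>\<^sup>+y\<in>ball x r. e2ennreal \<bar>u y - ereal m\<bar> \<partial>M) / emeasure M (ball x r)
      \<le> ennreal (C * r) * epowr ((\<integral>\<^sup>+y\<in>?B. epowr (G y) p \<partial>M) / emeasure M ?B) (1 / p)"
    unfolding m_def
    using r int measurable_restrict_space1[OF uM] weak_upper_gradient_restrict[OF ball_cball_sets(1) G(1)]
    by (intro P[THEN mp]) (simp add: u_def)
  then have "(\<integral>\<^sup>+y\<in>ball x r. e2ennreal \<bar>u y - ereal m\<bar> \<partial>M) = 0"
    using finite_balls[OF r, of x] unfolding G0 by auto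
  then have "AE y in M. e2ennreal \<bar>u y - ereal m\<bar> * indicator (ball x r) y = 0"
    by (subst (asm) nn_integral_0_iff_AE) auto
  then have "AE y in M. y \<in> ball x r \<longrightarrow> f y = m"
    by eventually_elim (auto simp: u_def split: split_indicator_asm)
  then show ?thesis by blast
qed

end

lemma ess_inf_on_geI: "AE y in M. y \<in> A \<longrightarrow> c \<le> u y \<Longrightarrow> c \<le> ess_inf_on M A u"
  unfolding ess_inf_on_def by (intro Sup_upper) simp

lemma less_ess_inf_onD:
  assumes "c < ess_inf_on M A u"
  obtains d where "c < d" "AE y in M. y \<in> A \<longrightarrow> d \<le> u y"
  using assms unfolding ess_inf_on_def less_Sup_iff by auto

text \<open>
  The essential lower limit of \<open>u\<close> at \<open>x\<close> only sees \<open>u\<close> up to null sets near \<open>x\<close>. If it were larger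
  than \<open>m < k\<close>, then \<open>u\<close> would exceed some \<open>d > m\<close> almost everywhere on a ball, which has positive
  measure, contradicting \<open>min u k = m\<close> there.
\<close>
lemma ess_liminf_eq_AE_const:
  fixes M :: "'a::metric_space measure" and u :: "'a \<Rightarrow> ereal"
  assumes u: "u x = ess_liminf M UNIV u x"
    and sets: "\<And>r. ball x r \<in> sets M" and pos: "\<And>r. 0 < r \<Longrightarrow> 0 < emeasure M (ball x r)"
    and U: "open U" "x \<in> U" and ae: "AE y in M. y \<in> U \<longrightarrow> min (u y) k = m"
  shows "min (u x) k = m"
proof (rule antisym)
  obtain e where e: "e > 0" "ball x e \<subseteq> U" using U by (meson openE)
  have witness: "\<exists>y. P y" if "AE y in M. y \<in> ball x s \<longrightarrow> P y" "0 < s" for P s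
  proof (rule ccontr)
    assume "\<nexists>y. P y"
    with that(1) have "AE y in M. y \<notin> ball x s" by simp
    then have "emeasure M (ball x s) = 0"
      using sets[of s] by (subst (asm) AE_iff_measurable[of "ball x s"]) (auto dest: sets.sets_into_space)
    with pos[OF that(2)] show False by simp
  qed
  have ball_ae: "AE y in M. y \<in> ball x e \<longrightarrow> min (u y) k = m"
    using ae by eventually_elim (use e(2) in blast)
  then obtain y where "min (u y) k = m" using witness[OF ball_ae e(1)] by blast
  then have mk: "m \<le> k" by auto
  have "m \<le> ess_inf_on M (UNIV \<inter> ball x e) u"
    by (rule ess_inf_on_geI) (use ball_ae in \<open>eventually_elim, auto\<close>)
  also have "\<dots> \<le> u x" unfolding u ess_liminf_def using e(1) by (intro SUP_upper) simp
  finally show "m \<le> min (u x) k" using mk by simp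
  show "min (u x) k \<le> m"
  proof (rule ccontr)
    assume "\<not> min (u x) k \<le> m"
    then have "m < u x" "m < k" by (simp_all add: not_le)
    then obtain \<rho> where \<rho>: "0 < \<rho>" "m < ess_inf_on M (UNIV \<inter> ball x \<rho>) u"
      unfolding u ess_liminf_def less_SUP_iff by auto
    obtain d where d: "m < d" "AE y in M. y \<in> UNIV \<inter> ball x \<rho> \<longrightarrow> d \<le> u y"
      using less_ess_inf_onD[OF \<rho>(2)] .
    have "AE y in M. y \<in> ball x (min e \<rho>) \<longrightarrow> min (u y) k = m \<and> d \<le> u y"
      using ball_ae d(2) by eventually_elim simp
    moreover have "0 < min e \<rho>" using e(1) \<rho>(1) by simp
    ultimately have "\<exists>y. min (u y) k = m \<and> d \<le> u y" by (rule witness)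
    then obtain y where "min (u y) k = m" "d \<le> u y" by blast
    with d(1) \<open>m < k\<close> show False by (simp add: min_def split: if_splits)
  qed
qed

theorem theorem1p8:
  fixes M :: "'a::metric_space measure" and p :: real and u :: "'a \<Rightarrow> ereal"
  assumes two_points: "\<exists>x y :: 'a. x \<noteq> y"
    and measure: "complete_borel_measure M"
    and balls: "\<And>x r. 0 < r \<Longrightarrow> 0 < emeasure M (ball x r) \<and> emeasure M (ball x r) < \<infinity>"
    and p: "1 < p"
    and proper: "proper_metric TYPE('a)"
    and connected: "connected (UNIV :: 'a set)"
    and doubling: "locally_doubling M"
    and poincare: "local_poincare M p"
    and parabolic_or_bounded: "p_parabolic M p \<or> bounded (UNIV :: 'a set)"
    and superharmonic: "quasisuperharmonic M p UNIV u"
    and nonneg: "\<And>x. 0 \<le> u x"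
  shows "u constant_on UNIV"
proof -
  interpret proper_borel_space M p
    by unfold_locales (use measure balls p proper in auto)
  obtain Q where Q: "1 \<le> Q" and u: "Q_quasisuperharmonic M p Q UNIV u"
    using superharmonic by (auto simp: quasisuperharmonic_def)
  have lsc: "u x = ess_liminf M UNIV u x" for x using u by (simp add: Q_quasisuperharmonic_def)
  have cap: "p_capacity M p K = 0" if "compact K" for K
    using parabolic_or_bounded p_capacity_bounded that by (auto simp: p_parabolic_def p_hyperbolic_def)
  have const: "(\<lambda>x. min (u x) (ereal k)) constant_on UNIV" if k: "0 \<le> k" for k
  proof -
    define f where "f x = real_of_ereal (min (u x) (ereal k))" for x
    have uf: "ereal (f x) = min (u x) (ereal k)" for x
      using nonneg[of x] k unfolding f_def by (cases "u x") (auto simp: min_def)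
    then have uf': "(\<lambda>x. min (u x) (ereal k)) = (\<lambda>x. ereal (f x))" by auto
    have f0: "0 \<le> f x" "f x \<le> k" for x
    proof -
      have "0 \<le> ereal (f x)" "ereal (f x) \<le> ereal k" unfolding uf using nonneg[of x] k by auto
      then show "0 \<le> f x" "f x \<le> k" by auto
    qed
    have qsm: "quasisuperminimizer M p Q UNIV (\<lambda>x. ereal (f x))"
      using u unfolding Q_quasisuperharmonic_def uf'[symmetric] by blast
    have newt: "(\<lambda>x. ereal (f x)) \<in> newtonian_loc M p UNIV" using qsm by (simp add: quasisuperminimizer_def)
    have fM: "f \<in> borel_measurable M" by (rule locally_newtonian_upper_gradient(1)[OF newt])
    obtain a where "borel_upper_gradient f a" using locally_newtonian_upper_gradient(2)[OF newt] by blast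
    then have "is_minimal_weak_upper_gradient M p (\<lambda>x. ereal (f x))
        (minimal_weak_upper_gradient M p (\<lambda>x. ereal (f x)))"
      by (intro minimal_weak_upper_gradient) (auto simp: borel_upper_gradient_def)
    then have G: "weak_upper_gradient M p (\<lambda>x. ereal (f x)) (minimal_weak_upper_gradient M p (\<lambda>x. ereal (f x)))"
      by (simp add: is_minimal_weak_upper_gradient_def)
    have "f x < k + 1" for x using f0(2)[of x] by simp
    then have G0: "AE x in M. minimal_weak_upper_gradient M p (\<lambda>x. ereal (f x)) x = 0"
      using k by (intro minimal_weak_upper_gradient_eq_0[OF qsm Q f0(1) _ _ cap]) auto
    show ?thesis
    proof (rule locally_constant_imp_constant[OF connected])
      fix x :: 'a
      obtain r where r: "0 < r" "poincare_within M p (ball x r)"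
        using poincare by (auto simp: local_poincare_def)
      obtain m where m: "AE y in M. y \<in> ball x r \<longrightarrow> f y = m"
        using AE_eq_const_on_ball[OF r(2,1) _ fM f0 G G0] balls[OF r(1)] by blast
      have "min (u y) (ereal k) = ereal m" if "y \<in> ball x r" for y
        by (rule ess_liminf_eq_AE_const[OF lsc ball_cball_sets(1) _ open_ball that])
          (use m balls in \<open>auto simp flip: uf elim!: eventually_mono\<close>)
      then show "\<exists>T. openin (top_of_set UNIV) T \<and> x \<in> T \<and>
          (\<forall>y\<in>T. min (u y) (ereal k) = min (u x) (ereal k))"
        using r(1) by (intro exI[of _ "ball x r"]) auto
    qed
  qed
  have "u x \<le> u y" for x y
  proof (rule ccontr)
    assume "\<not> u x \<le> u y"
    then have "u y < u x" by simp
    then obtain k where k: "u y < ereal k" "ereal k < u x" using ereal_dense2 by blast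
    then have "0 \<le> k" using nonneg[of y] by (metis ereal_less_eq(5) less_imp_le order_trans)
    then have "min (u x) (ereal k) = min (u y) (ereal k)" using const[OF \<open>0 \<le> k\<close>] unfolding constant_on_def by (metis UNIV_I)
    with k show False by (auto simp: min_def split: if_splits)
  qed
  then show ?thesis unfolding constant_on_def by (metis antisym UNIV_I)
qed

end
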